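(* Let $A$ be an $N\times N$ Hermitian matrix whose eigenvalues form an arithmetic progression: there is $\hbar>0$ such that $a_i=a_1+(i-1)\hbar$ for $1\le i\le N$. Then for any $N\times N$ Hermitian matrix $B$ with eigenvalues $b_1<\dots<b_N$, the HCIZ integral $\mathbf{I}_N(z;A,B)$ vanishes at each of the pure imaginary points \[ z=\frac{2k\pi}{N\hbar(b_j-b_i)}\sqrt{-1},\qquad 1\le i<j\le N,\ k\in\mathbb{Z}\setminus\{0\}. \]
   Context: $\mathbf{I}_N(z;A,B)=\int_{\mathrm{U}(N)}e^{-zN\operatorname{Tr}(AUBU^{-1})}\kappa_N(\mathrm{d}U)$, $z\in\mathbb{C}$, where $\kappa_N$ is the normalized Haar measure on the unitary group $\mathrm{U}(N)$. *)

theory Defs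
  imports "HOL-Probability.Probability"
begin

definition conj_transpose :: "complex ^ 'n ^ 'm \<Rightarrow> complex ^ 'm ^ 'n" where
  "conj_transpose A = (\<chi> i j. cnj (A $ j $ i))"

definition hermitian :: "complex ^ 'n ^ 'n \<Rightarrow> bool" where
  "hermitian A \<longleftrightarrow> conj_transpose A = A"

definition eigenvalue :: "complex ^ 'n ^ 'n \<Rightarrow> complex \<Rightarrow> bool" where
  "eigenvalue A c \<longleftrightarrow> (\<exists>v. v \<noteq> 0 \<and> A *v v = c *s v)"

definition unitary_group :: "(complex ^ 'n ^ 'n) set" where
  "unitary_group = {U. conj_transpose U ** U = mat 1 \<and> U ** conj_transpose U = mat 1}"

text \<open>
  A measure is the normalized Haar measure of the unitary group if it is a left-invariant
  Borel probability measure on it.  Such a measure exists, is unique, and is also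
  right-invariant, since the group is compact; none of these facts is built into the definition.
\<close>

definition normalized_haar_unitary :: "(complex ^ 'n ^ 'n) measure \<Rightarrow> bool" where
  "normalized_haar_unitary \<kappa> \<longleftrightarrow>
     prob_space \<kappa> \<and>
     space \<kappa> = unitary_group \<and>
     sets \<kappa> = sets (restrict_space borel unitary_group) \<and>
     (\<forall>V \<in> unitary_group. distr \<kappa> \<kappa> (\<lambda>U. V ** U) = \<kappa>)"

definition hciz ::
  "(complex ^ 'n ^ 'n) measure \<Rightarrow> complex \<Rightarrow> complex ^ 'n ^ 'n \<Rightarrow> complex ^ 'n ^ 'n \<Rightarrow> complex" where
  "hciz \<kappa> z A B =
     (\<integral>U. exp (- z * of_nat CARD('n) * trace (A ** U ** B ** matrix_inv U)) \<partial>\<kappa>)"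

text \<open>
  The Bochner integral of a non-integrable function is 0 by convention.  The facts below show
  that this convention plays no role in the definition of the HCIZ integral.
\<close>

lemma matrix_inv_unitary:
  assumes "U \<in> unitary_group"
  shows "matrix_inv U = conj_transpose U"
proof -
  have *: "U ** conj_transpose U = mat 1" "conj_transpose U ** U = mat 1"
    using assms by (auto simp: unitary_group_def)
  have "U ** matrix_inv U = mat 1 \<and> matrix_inv U ** U = mat 1"
    unfolding matrix_inv_def using * by (rule_tac someI_ex) blast
  then have "matrix_inv U = (conj_transpose U ** U) ** matrix_inv U" using * by simp
  also have "\<dots> = conj_transpose U"
    using \<open>U ** matrix_inv U = mat 1 \<and> _\<close> by (simp flip: matrix_mul_assoc)
  finally show ?thesis .
qed

lemma norm_entry_unitary:
  fixes U :: "complex ^ 'n ^ 'n"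
  assumes "U \<in> unitary_group"
  shows "norm (U $ i $ j) \<le> 1"
proof -
  have "(U ** conj_transpose U) $ i $ i = 1"
    using assms by (simp add: unitary_group_def mat_def)
  then have "(\<Sum>k\<in>UNIV. U $ i $ k * cnj (U $ i $ k)) = 1"
    by (simp add: matrix_matrix_mult_def conj_transpose_def)
  then have "of_real (\<Sum>k\<in>UNIV. (norm (U $ i $ k))\<^sup>2) = (1 :: complex)"
    by (simp add: complex_norm_square del: of_real_power)
  then have "(\<Sum>k\<in>UNIV. (norm (U $ i $ k))\<^sup>2) = 1"
    using of_real_eq_1_iff by blast
  moreover have "(norm (U $ i $ j))\<^sup>2 \<le> (\<Sum>k\<in>UNIV. (norm (U $ i $ k))\<^sup>2)"
    by (rule member_le_sum) auto
  ultimately show ?thesis by (simp add: power_le_one_iff)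
qed

lemma compact_unitary_group: "compact (unitary_group :: (complex ^ 'n ^ 'n) set)"
proof -
  have "norm U \<le> real CARD('n) * real CARD('n)" if "U \<in> unitary_group" for U :: "complex ^ 'n ^ 'n"
  proof -
    have row: "norm (U $ i) \<le> real CARD('n)" for i
    proof -
      have "norm (U $ i) \<le> (\<Sum>j\<in>UNIV. norm (U $ i $ j))"
        unfolding norm_vec_def by (rule L2_set_le_sum) auto
      also have "\<dots> \<le> (\<Sum>j\<in>(UNIV :: 'n set). 1)"
        by (intro sum_mono norm_entry_unitary that)
      finally show ?thesis by simp
    qed
    have "norm U \<le> (\<Sum>i\<in>UNIV. norm (U $ i))"
      unfolding norm_vec_def by (rule L2_set_le_sum) auto
    also have "\<dots> \<le> (\<Sum>i\<in>(UNIV :: 'n set). real CARD('n))"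
      by (intro sum_mono row)
    finally show ?thesis by simp
  qed
  then have "bounded (unitary_group :: (complex ^ 'n ^ 'n) set)"
    by (auto simp: bounded_iff)
  moreover have "closed (unitary_group :: (complex ^ 'n ^ 'n) set)"
    unfolding unitary_group_def conj_transpose_def matrix_matrix_mult_def
    by (intro closed_Collect_conj closed_Collect_eq continuous_intros)
  ultimately show ?thesis by (simp add: compact_eq_bounded_closed)
qed

lemma hciz_integrable:
  fixes A B :: "complex ^ 'n ^ 'n"
  assumes "normalized_haar_unitary \<kappa>"
  shows "integrable \<kappa> (\<lambda>U. exp (- z * of_nat CARD('n) * trace (A ** U ** B ** matrix_inv U)))"
proof -
  interpret prob_space \<kappa> using assms by (simp add: normalized_haar_unitary_def)
  have sp: "space \<kappa> = unitary_group"
    and se: "sets \<kappa> = sets (restrict_space borel unitary_group)"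
    using assms by (auto simp: normalized_haar_unitary_def)
  define f where "f = (\<lambda>U. exp (- z * of_nat CARD('n) * trace (A ** U ** B ** conj_transpose U)))"
  have cont: "continuous_on unitary_group f"
    unfolding f_def trace_def conj_transpose_def matrix_matrix_mult_def
    by (simp, intro continuous_intros)
  have "bounded (f ` unitary_group)"
    by (intro compact_imp_bounded compact_continuous_image cont compact_unitary_group)
  then obtain C where C: "\<And>U. U \<in> unitary_group \<Longrightarrow> norm (f U) \<le> C"
    by (auto simp: bounded_iff)
  have "f \<in> borel_measurable (restrict_space borel unitary_group)"
    by (rule borel_measurable_continuous_on_restrict[OF cont])
  then have "f \<in> borel_measurable \<kappa>"
    using measurable_cong_sets[OF se refl, where ?'b = complex] by blast
  then have "integrable \<kappa> f"
    by (rule integrable_const_bound[rotated, where B = C]) (auto simp: sp C)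
  moreover have "integrable \<kappa> f \<longleftrightarrow> ?thesis"
    by (rule Bochner_Integration.integrable_cong) (simp_all add: f_def sp matrix_inv_unitary)
  ultimately show ?thesis by simp
qed

end

theory Submission
  imports Defs
begin

text \<open>
  Haar measure is invariant under inversion, so after diagonalizing \<open>B\<close> the integral becomes the
  average of \<open>exp (\<tau> \<Sum>\<^sub>l b\<^sub>l X\<^sub>l\<^sub>l)\<close> over \<open>X = U A U\<^sup>*\<close>, where \<open>\<tau> = - z N\<close>. Regard it as a function
  \<open>F\<close> of the single variable \<open>x = b\<^sub>p\<close> and let \<open>P x = \<Prod> (x - b\<^sub>l)\<close> over \<open>l \<noteq> p\<close>.
  Integrating by parts along rotations (Schwinger--Dyson equations) and expanding the characteristic
  polynomial of \<open>X\<close>, which is that of \<open>A\<close>, along row \<open>p\<close> gives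
  \<open>\<chi>(c) P(x) F(x) = c H(c, x) - \<partial>\<^sub>x H(c, x) / \<tau>\<close> for all \<open>c\<close>, where \<open>H\<close> is a polynomial in \<open>c\<close> of degree
  less than \<open>N\<close>. At the eigenvalues \<open>c\<close> of \<open>A\<close> this forces \<open>H(c, x)\<close> to be a multiple of
  \<open>exp (\<tau> c x)\<close>. If the spectrum of \<open>A\<close> is an arithmetic progression and \<open>z\<close> is one of the given points,
  all these exponentials are multiplied by the same factor when \<open>x\<close> is shifted by \<open>b\<^sub>p - b\<^sub>q\<close>. By interpolation
  the same holds for \<open>H\<close>, hence for \<open>P F\<close>. Since \<open>P\<close> vanishes at \<open>b\<^sub>q\<close> but not at \<open>b\<^sub>p\<close>, \<open>F\<close> vanishes at \<open>b\<^sub>p\<close>.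
\<close>

subsection \<open>Determinants and principal minors\<close>

definition set_row :: "'a ^ 'n ^ 'm \<Rightarrow> 'm \<Rightarrow> 'a ^ 'n \<Rightarrow> 'a ^ 'n ^ 'm" where
  "set_row M r v = (\<chi> i. if i = r then v else M $ i)"

lemma set_row_nth: "set_row M r v $ i = (if i = r then v else M $ i)"
  by (simp add: set_row_def)

lemma set_row_self [simp]: "set_row M r (M $ r) = M"
  by (simp add: set_row_def vec_eq_iff)

lemma det_set_row_add:
  "det (set_row M r (u + v)) = det (set_row M r u) + det (set_row M r (v :: 'a::comm_ring_1 ^ 'n))"
  using det_row_add[of r "\<lambda>_. u" "\<lambda>_. v" "\<lambda>i. M $ i"] by (simp add: set_row_def)

lemma det_set_row_scale:
  "det (set_row M r (c *s v)) = c * det (set_row M r (v :: 'a::comm_ring_1 ^ 'n))"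
  using det_row_mul[of r c "\<lambda>_. v" "\<lambda>i. M $ i"] by (simp add: set_row_def)

lemma det_set_row_0 [simp]: "det (set_row M r (0 :: 'a::comm_ring_1 ^ 'n)) = 0"
  using det_set_row_scale[of M r 0 0] by simp

lemma det_set_row_diff:
  "det (set_row M r (u - v)) = det (set_row M r u) - det (set_row M r (v :: 'a::comm_ring_1 ^ 'n))"
  using det_set_row_add[of M r "u - v" v] by simp

lemma det_set_row_minus:
  "det (set_row M r (- v)) = - det (set_row M r (v :: 'a::comm_ring_1 ^ 'n))"
  using det_set_row_diff[of M r 0 v] by simp

lemma det_set_row_sum:
  assumes "finite S"
  shows "det (set_row M r (\<Sum>k\<in>S. f k)) = (\<Sum>k\<in>S. det (set_row M r (f k :: 'a::comm_ring_1 ^ 'n)))"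
  using assms by induction (auto simp: det_set_row_add)

text \<open>Laplace expansion along row \<open>r\<close>. The cofactors are written as determinants
  of full size with a unit vector in row \<open>r\<close>, which keeps one index type for matrices
  and minors alike.\<close>

lemma det_set_row_expand:
  "det (set_row M r v) = (\<Sum>c\<in>UNIV. v $ c * det (set_row M r (axis c 1 :: 'a::comm_ring_1 ^ 'n)))"
proof -
  have "det (set_row M r v) = det (set_row M r (\<Sum>c\<in>UNIV. v $ c *s axis c 1))"
    by (simp add: basis_expansion)
  then show ?thesis by (simp add: det_set_row_sum det_set_row_scale)
qed

lemma det_set_row_eq:
  assumes "i \<noteq> j" "M $ j = v"
  shows "det (set_row M i (v :: 'a::comm_ring_1 ^ 'n)) = 0"
  by (rule det_identical_rows[OF assms(1)]) (use assms in \<open>simp add: set_row_nth row_def\<close>)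

lemma set_row_commute: "i \<noteq> j \<Longrightarrow> set_row (set_row M i u) j v = set_row (set_row M j v) i u"
  by (auto simp: set_row_def vec_eq_iff)

text \<open>Polarization: the determinant with \<open>u + v\<close> in both rows vanishes, and so do
  the two terms with equal rows.\<close>

lemma det_set_row_swap:
  assumes "i \<noteq> j"
  shows "det (set_row (set_row M i u) j v) = - det (set_row (set_row M i v) j (u :: 'a::comm_ring_1 ^ 'n))"
proof -
  have *: "det (set_row (set_row M i w) j w) = 0" for w
    by (rule det_set_row_eq[OF assms[symmetric]]) (simp add: set_row_nth)
  have add: "det (set_row (set_row M i (x + y)) j w) =
      det (set_row (set_row M i x) j w) + det (set_row (set_row M i y) j w)" for x y w
    by (simp add: set_row_commute[OF assms] det_set_row_add)
  have "0 = det (set_row (set_row M i (u + v)) j (u + v))" by (simp add: *)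
  then show ?thesis by (simp add: add det_set_row_add * eq_neg_iff_add_eq_0 add.commute)
qed

text \<open>Column expansion with the same row-type cofactors. Putting a unit vector into column
  \<open>j\<close> or into row \<open>r\<close> gives the same determinant, because in both only the
  permutations sending \<open>r\<close> to \<open>j\<close> contribute, with equal products.\<close>

lemma det_column_expand:
  fixes M :: "'a::comm_ring_1 ^ 'n ^ 'n"
  shows "det M = (\<Sum>r\<in>UNIV. M $ r $ j * det (set_row M r (axis j 1)))"
proof -
  have "det (set_row (transpose M) j (axis r 1)) = det (set_row M r (axis j 1))" for r
  proof -
    have "det (set_row (transpose M) j (axis r 1)) = det (transpose (set_row (transpose M) j (axis r 1)))"
      by simp
    also have "\<dots> = det (set_row M r (axis j 1))"
      unfolding det_def
    proof (rule sum.cong[OF refl], clarsimp)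
      fix \<sigma> :: "'n \<Rightarrow> 'n" assume perm: "\<sigma> permutes UNIV"
      let ?f = "\<lambda>i. transpose (set_row (transpose M) j (axis r 1)) $ i $ \<sigma> i"
      let ?g = "\<lambda>i. set_row M r (axis j 1) $ i $ \<sigma> i"
      have "prod ?f UNIV = prod ?g UNIV"
      proof (cases "\<sigma> r = j")
        case True
        have "\<sigma> i = j \<longleftrightarrow> i = r" for i
          using permutes_inj[OF perm] True by (auto dest: injD)
        then have "?f i = ?g i" for i
          by (simp add: transpose_def set_row_nth axis_def)
        then show ?thesis by simp
      next
        case False
        obtain i where i: "\<sigma> i = j" using permutes_surj[OF perm] by (metis surjD)
        then have "?f i = 0" using False by (auto simp: transpose_def set_row_nth axis_def)
        moreover have "?g r = 0" using False by (simp add: set_row_nth axis_def)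
        ultimately show ?thesis by (metis (mono_tags, lifting) UNIV_I finite prod_zero)
      qed
      then show "of_int (sign \<sigma>) * prod ?f UNIV = of_int (sign \<sigma>) * prod ?g UNIV" by simp
    qed
    finally show ?thesis .
  qed
  moreover have "transpose M $ j $ r = M $ r $ j" for r
    by (simp add: transpose_def)
  ultimately show ?thesis
    using det_set_row_expand[of "transpose M" j "transpose M $ j"] by simp
qed

text \<open>The rows outside \<open>I\<close> are those of the identity matrix, so the determinant of
  \<open>char_minor I X c\<close> is the characteristic polynomial of the principal submatrix of \<open>X\<close>
  on \<open>I\<close>, evaluated at \<open>c\<close>.\<close>

definition char_minor :: "'n set \<Rightarrow> 'a::comm_ring_1 ^ 'n ^ 'n \<Rightarrow> 'a \<Rightarrow> 'a ^ 'n ^ 'n" where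
  "char_minor I X c = (\<chi> r. if r \<in> I then c *s axis r 1 - X $ r else axis r 1)"

lemma char_minor_nth: "char_minor I X c $ r = (if r \<in> I then c *s axis r 1 - X $ r else axis r 1)"
  by (simp add: char_minor_def)

lemma char_minor_insert:
  "char_minor (insert p J) X c = set_row (char_minor J X c) p (c *s axis p 1 - X $ p)"
  by (auto simp: vec_eq_iff char_minor_nth set_row_nth)

lemma char_minor_remove:
  "char_minor (J - {j}) X c = set_row (char_minor J X c) j (axis j 1)"
  by (auto simp: vec_eq_iff char_minor_nth set_row_nth)

text \<open>Expansion along row \<open>p\<close>. A column \<open>j\<close> outside
  \<open>insert p J\<close> contributes nothing, since its cofactor contains the unit row
  \<open>axis j 1\<close> twice.\<close>

lemma det_char_minor_insert:
  assumes "p \<notin> J"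
  shows "det (char_minor (insert p J) X c) = (c - X $ p $ p) * det (char_minor J X c)
    - (\<Sum>j\<in>J. X $ p $ j * det (set_row (char_minor J X c) p (axis j 1)))"
proof -
  let ?M = "char_minor J X c"
  have self: "set_row ?M p (axis p 1) = ?M"
    using assms by (metis char_minor_nth set_row_self)
  have zero: "det (set_row ?M p (axis j 1)) = 0" if "j \<notin> J" "j \<noteq> p" for j
    by (rule det_set_row_eq[of p j]) (use that in \<open>auto simp: char_minor_nth\<close>)
  have "det (set_row ?M p (X $ p)) = (\<Sum>j\<in>insert p J. X $ p $ j * det (set_row ?M p (axis j 1)))"
    unfolding det_set_row_expand[of ?M p "X $ p"]
    by (rule sum.mono_neutral_right) (auto simp: zero)
  also have "\<dots> = X $ p $ p * det ?M + (\<Sum>j\<in>J. X $ p $ j * det (set_row ?M p (axis j 1)))"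
    using assms by (simp add: self)
  finally show ?thesis
    by (simp add: char_minor_insert det_set_row_diff det_set_row_scale self algebra_simps)
qed

text \<open>The left-hand side is the derivative of \<open>det (set_row (char_minor J X c) p (axis j 1))\<close>
  when \<open>X\<close> moves with velocity \<open>K ** X - X ** K\<close>, where \<open>K\<close> is the matrix unit at \<open>(j, p)\<close>.\<close>

lemma det_char_minor_variation:
  fixes X :: "'a::comm_ring_1 ^ 'n ^ 'n"
  assumes "p \<notin> J" "j \<in> J"
  shows "(\<Sum>r\<in>J. det (set_row (set_row (char_minor J X c) p (axis j 1)) r
            (X $ r $ j *s axis p 1 - (if r = j then X $ p else 0))))
       = det (char_minor J X c) - det (char_minor (insert p (J - {j})) X c)"
proof -
  let ?M = "char_minor J X c"
  have pj: "p \<noteq> j" using assms by auto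
  have self: "set_row ?M p (axis p 1) = ?M"
    using assms by (metis char_minor_nth set_row_self)
  have swap: "det (set_row (set_row ?M p (axis j 1)) r (axis p 1)) = - det (set_row ?M r (axis j 1))"
    if "r \<in> J" for r
    using det_set_row_swap[of p r ?M "axis j 1" "axis p 1"] that assms by (auto simp: self)
  \<comment> \<open>Rows outside \<open>J\<close> are unit vectors other than
    \<open>axis j 1\<close>, so they vanish in column \<open>j\<close>; the column expansion thus
    evaluates the sum weighted by \<open>X $ r $ j\<close>.\<close>
  have "det ?M = (\<Sum>r\<in>J. ?M $ r $ j * det (set_row ?M r (axis j 1)))"
    unfolding det_column_expand[of ?M j]
    by (rule sum.mono_neutral_right) (use assms in \<open>auto simp: char_minor_nth axis_def\<close>)
  also have "\<dots> = (\<Sum>r\<in>J. (if r = j then c * det (set_row ?M r (axis j 1)) else 0)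
       - X $ r $ j * det (set_row ?M r (axis j 1)))"
    by (rule sum.cong) (auto simp: char_minor_nth axis_def algebra_simps)
  also have "\<dots> = c * det (set_row ?M j (axis j 1)) - (\<Sum>r\<in>J. X $ r $ j * det (set_row ?M r (axis j 1)))"
    using assms by (simp add: sum_subtractf)
  finally have col: "(\<Sum>r\<in>J. X $ r $ j * det (set_row ?M r (axis j 1))) = c * det (set_row ?M j (axis j 1)) - det ?M"
    by (simp add: algebra_simps)
  have "(\<Sum>r\<in>J. det (set_row (set_row ?M p (axis j 1)) r
            (X $ r $ j *s axis p 1 - (if r = j then X $ p else 0))))
     = (\<Sum>r\<in>J. X $ r $ j * det (set_row (set_row ?M p (axis j 1)) r (axis p 1))
           - (if r = j then det (set_row (set_row ?M p (axis j 1)) j (X $ p)) else 0))"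
    by (rule sum.cong) (auto simp: det_set_row_diff det_set_row_scale)
  also have "\<dots> = (\<Sum>r\<in>J. - (X $ r $ j * det (set_row ?M r (axis j 1))))
           - det (set_row (set_row ?M p (axis j 1)) j (X $ p))"
    using assms by (simp add: sum_subtractf swap)
  also have "\<dots> = det ?M - c * det (set_row ?M j (axis j 1)) + det (set_row (set_row ?M p (X $ p)) j (axis j 1))"
    using det_set_row_swap[OF pj, of ?M "axis j 1" "X $ p"] by (simp add: sum_negf col)
  also have "\<dots> = det ?M - det (char_minor (insert p (J - {j})) X c)"
    using pj
    by (simp add: char_minor_insert char_minor_remove det_set_row_diff det_set_row_scale
        set_row_commute[of p j] self flip: set_row_commute[of j p])
       (metis assms(1) set_row_commute self)
  finally show ?thesis .
qed

section \<open>Derivatives of products and determinants\<close>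

lemma has_vector_derivative_prod:
  fixes f :: "'i \<Rightarrow> real \<Rightarrow> 'a::real_normed_field"
  assumes "\<And>i. i \<in> I \<Longrightarrow> (f i has_vector_derivative f' i) (at x within S)"
  shows "((\<lambda>x. \<Prod>i\<in>I. f i x) has_vector_derivative (\<Sum>i\<in>I. f' i * (\<Prod>j\<in>I - {i}. f j x))) (at x within S)"
proof -
  have "((\<lambda>x. \<Prod>i\<in>I. f i x) has_derivative (\<lambda>y. \<Sum>i\<in>I. y *\<^sub>R f' i * (\<Prod>j\<in>I - {i}. f j x))) (at x within S)"
    by (rule has_derivative_prod) (use assms in \<open>auto simp: has_vector_derivative_def\<close>)
  then show ?thesis by (simp add: has_vector_derivative_def scaleR_sum_right)
qed

text \<open>Multilinearity in the rows: one row at a time is replaced by its velocity.\<close>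

lemma has_vector_derivative_det:
  fixes M :: "real \<Rightarrow> 'a::real_normed_field ^ 'n ^ 'n"
  assumes "\<And>r c. ((\<lambda>s. M s $ r $ c) has_vector_derivative M' $ r $ c) (at x within S)"
  shows "((\<lambda>s. det (M s)) has_vector_derivative (\<Sum>r\<in>UNIV. det (set_row (M x) r (M' $ r)))) (at x within S)"
proof -
  have "((\<lambda>s. det (M s)) has_vector_derivative
      (\<Sum>\<sigma> | \<sigma> permutes UNIV. of_int (sign \<sigma>) *
        (\<Sum>r\<in>UNIV. M' $ r $ \<sigma> r * (\<Prod>i\<in>UNIV - {r}. M x $ i $ \<sigma> i)))) (at x within S)"
    unfolding det_def
    by (intro has_vector_derivative_sum has_vector_derivative_mult_right has_vector_derivative_prod assms)
  also have "(\<Sum>\<sigma> | \<sigma> permutes UNIV. of_int (sign \<sigma>) *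
        (\<Sum>r\<in>UNIV. M' $ r $ \<sigma> r * (\<Prod>i\<in>UNIV - {r}. M x $ i $ \<sigma> i)))
     = (\<Sum>r\<in>UNIV. \<Sum>\<sigma> | \<sigma> permutes UNIV. of_int (sign \<sigma>) * (M' $ r $ \<sigma> r * (\<Prod>i\<in>UNIV - {r}. M x $ i $ \<sigma> i)))"
    unfolding sum_distrib_left by (rule sum.swap)
  also have "\<dots> = (\<Sum>r\<in>UNIV. det (set_row (M x) r (M' $ r)))"
    unfolding det_def
  proof (intro sum.cong refl arg_cong2[where f = "(*)"])
    fix r :: 'n and \<sigma> :: "'n \<Rightarrow> 'n"
    have "(\<Prod>i\<in>UNIV - {r}. M x $ i $ \<sigma> i) = (\<Prod>i\<in>UNIV - {r}. set_row (M x) r (M' $ r) $ i $ \<sigma> i)"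
      by (rule prod.cong) (auto simp: set_row_nth)
    then show "M' $ r $ \<sigma> r * (\<Prod>i\<in>UNIV - {r}. M x $ i $ \<sigma> i) = (\<Prod>i\<in>UNIV. set_row (M x) r (M' $ r) $ i $ \<sigma> i)"
      by (simp add: prod.remove[of UNIV r] set_row_nth)
  qed
  finally show ?thesis .
qed

section \<open>Polynomials in the spectral variable \<open>c\<close>\<close>

lemma poly_det: "poly (det P) c = det (\<chi> i j. poly (P $ i $ j) c)"
  for P :: "'a::comm_ring_1 poly ^ 'n ^ 'n"
  by (simp add: det_def poly_sum poly_prod)

text \<open>Only the rows in \<open>J\<close> involve \<open>c\<close>, each entry at most linearly.
  If \<open>J\<close> misses an index, the degree is below \<open>CARD('n)\<close>, as interpolation
  at the eigenvalues of \<open>A\<close> requires.\<close>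

lemma degree_det_char_minor:
  fixes X :: "'a::idom ^ 'n ^ 'n"
  obtains q where "degree q \<le> card J" "\<And>c. det (char_minor J X c) = poly q c"
proof
  define P :: "'a poly ^ 'n ^ 'n" where
    "P = (\<chi> r s. if r \<in> J then [:- X $ r $ s, axis r 1 $ s:] else [:axis r 1 $ s:])"
  show "det (char_minor J X c) = poly (det P) c" for c
    unfolding poly_det
    by (rule arg_cong[where f = det]) (auto simp: vec_eq_iff P_def char_minor_nth algebra_simps)
  show "degree (det P) \<le> card J"
    unfolding det_def
  proof (rule degree_sum_le)
    fix \<sigma> :: "'n \<Rightarrow> 'n"
    have "degree (of_int (sign \<sigma>) * (\<Prod>i\<in>UNIV. P $ i $ \<sigma> i)) \<le> degree (\<Prod>i\<in>UNIV. P $ i $ \<sigma> i)"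
      using degree_mult_le[of "of_int (sign \<sigma>)" "\<Prod>i\<in>UNIV. P $ i $ \<sigma> i"] by (simp add: degree_of_int)
    also have "\<dots> \<le> (\<Sum>i\<in>UNIV. degree (P $ i $ \<sigma> i))"
      using degree_prod_sum_le[of UNIV "\<lambda>i. P $ i $ \<sigma> i"] by (simp add: o_def)
    also have "\<dots> \<le> (\<Sum>i\<in>UNIV. if i \<in> J then 1 else 0)"
      by (rule sum_mono) (simp add: P_def)
    finally show "degree (of_int (sign \<sigma>) * (\<Prod>i\<in>UNIV. P $ i $ \<sigma> i)) \<le> card J"
      by (simp add: sum.If_cases)
  qed simp
qed

text \<open>The weights \<open>l m c\<close> are fixed before \<open>q\<close>. The identity is
  linear in the values at the nodes, so it survives sums and averages and later stands for being a
  polynomial in \<open>c\<close> of degree below \<open>CARD('n)\<close>.\<close>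

lemma lagrange_interpolation:
  fixes \<alpha> :: "'n::finite \<Rightarrow> 'a::field"
  assumes "inj \<alpha>"
  obtains l where "\<And>q c. degree q < CARD('n) \<Longrightarrow> poly q c = (\<Sum>m\<in>UNIV. poly q (\<alpha> m) * l m c)"
proof
  define L where "L m = (\<Prod>k\<in>UNIV - {m}. [:- \<alpha> k / (\<alpha> m - \<alpha> k), 1 / (\<alpha> m - \<alpha> k):])" for m
  fix q :: "'a poly" and c
  assume deg: "degree q < CARD('n)"
  have deg_L: "degree (L m) < CARD('n)" for m
  proof -
    have "degree (L m) \<le> (\<Sum>k\<in>UNIV - {m}. degree [:- \<alpha> k / (\<alpha> m - \<alpha> k), 1 / (\<alpha> m - \<alpha> k):])"
      unfolding L_def
      using degree_prod_sum_le[of "UNIV - {m}" "\<lambda>k. [:- \<alpha> k / (\<alpha> m - \<alpha> k), 1 / (\<alpha> m - \<alpha> k):]"]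
      by (simp add: o_def)
    also have "\<dots> \<le> (\<Sum>k\<in>UNIV - {m}. 1)" by (rule sum_mono) simp
    also have "\<dots> < CARD('n)" by (simp add: card_Diff_singleton_if)
    finally show ?thesis .
  qed
  have L: "poly (L m) (\<alpha> k) = (if k = m then 1 else 0)" for m k
  proof (cases "k = m")
    case True
    have "poly (L m) (\<alpha> m) = (\<Prod>k\<in>UNIV - {m}. 1)"
      unfolding L_def poly_prod
      by (rule prod.cong) (use injD[OF assms] in \<open>auto simp: divide_simps add_divide_distrib[symmetric]\<close>)
    then show ?thesis using True by simp
  next
    case False
    then show ?thesis
      by (auto simp: L_def poly_prod intro!: prod_zero bexI[of _ k])
  qed
  have "q = (\<Sum>m\<in>UNIV. smult (poly q (\<alpha> m)) (L m))"
  proof (rule poly_eqI_degree[of "range \<alpha>"])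
    show "degree q < card (range \<alpha>)" using deg by (simp add: card_image assms)
    have "degree (\<Sum>m\<in>UNIV. smult (poly q (\<alpha> m)) (L m)) < CARD('n)"
      by (rule degree_sum_less) (simp_all add: deg_L)
    then show "degree (\<Sum>m\<in>UNIV. smult (poly q (\<alpha> m)) (L m)) < card (range \<alpha>)"
      by (simp add: card_image assms)
  qed (auto simp: poly_sum L mult_delta_right)
  then have "poly q c = poly (\<Sum>m\<in>UNIV. smult (poly q (\<alpha> m)) (L m)) c" by simp
  then show "poly q c = (\<Sum>m\<in>UNIV. poly q (\<alpha> m) * poly (L m) c)" by (simp add: poly_sum)
qed

subsection \<open>Differentiation under the integral\<close>

text \<open>Dominated convergence for the normalized remainder \<open>R\<close> of the first-order
  expansion. The mean value inequality turns the bound on \<open>f'\<close> near \<open>x0\<close>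
  into the constant majorant \<open>2 * C\<close>.\<close>

lemma has_vector_derivative_integral:
  fixes f f' :: "real \<Rightarrow> 'a \<Rightarrow> 'b::{banach, second_countable_topology}"
  assumes "finite_measure M"
    and int: "\<And>x. integrable M (f x)" "integrable M (f' x0)"
    and deriv: "\<And>x \<omega>. \<omega> \<in> space M \<Longrightarrow> ((\<lambda>x. f x \<omega>) has_vector_derivative f' x \<omega>) (at x)"
    and bound: "\<And>x \<omega>. \<omega> \<in> space M \<Longrightarrow> \<bar>x - x0\<bar> < 1 \<Longrightarrow> norm (f' x \<omega>) \<le> C"
  shows "((\<lambda>x. \<integral>\<omega>. f x \<omega> \<partial>M) has_vector_derivative (\<integral>\<omega>. f' x0 \<omega> \<partial>M)) (at x0)"
proof -
  interpret finite_measure M by fact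
  \<comment> \<open>The ball on which \<open>bound\<close> holds. It is convex, for the mean value
    inequality, and open, so that the derivative within it is the full derivative.\<close>
  define S where "S = ball x0 1"
  have x0: "x0 \<in> S" by (simp add: S_def)
  define R where "R y \<omega> = (f y \<omega> - f x0 \<omega> - (y - x0) *\<^sub>R f' x0 \<omega>) /\<^sub>R norm (y - x0)" for y \<omega>
  have lim_R: "((\<lambda>y. R y \<omega>) \<longlongrightarrow> 0) (at x0 within S)" if "\<omega> \<in> space M" for \<omega>
    using has_vector_derivative_at_within[OF deriv[OF that], of x0 S]
    by (simp add: has_vector_derivative_def has_derivative_at_within R_def)
  have bound_R: "norm (R y \<omega>) \<le> 2 * C" if \<omega>: "\<omega> \<in> space M" and y: "y \<in> S" "y \<noteq> x0" for y \<omega>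
  proof -
    have C: "0 \<le> C" "norm (f' x0 \<omega>) \<le> C" using bound[OF \<omega>, of x0] order_trans[OF norm_ge_zero, of "f' x0 \<omega>" C] by auto
    have "norm (f y \<omega> - f x0 \<omega>) \<le> C * norm (y - x0)"
    proof (rule differentiable_bound)
      show "convex S" by (simp add: S_def)
      show "((\<lambda>y. f y \<omega>) has_derivative (\<lambda>h. h *\<^sub>R f' x \<omega>)) (at x within S)" for x
        using has_vector_derivative_at_within[OF deriv[OF \<omega>], of x S] by (simp add: has_vector_derivative_def)
      show "onorm (\<lambda>h. h *\<^sub>R f' x \<omega>) \<le> C" if "x \<in> S" for x
      proof (rule onorm_bound[OF C(1)])
        have "norm (f' x \<omega>) \<le> C"
          using bound[OF \<omega>, of x] that by (simp add: S_def dist_real_def abs_minus_commute)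
        then show "norm (h *\<^sub>R f' x \<omega>) \<le> C * norm h" for h
          using mult_right_mono[of "norm (f' x \<omega>)" C "norm h"] by (simp add: mult.commute)
      qed
    qed (use x0 y in auto)
    moreover have "norm ((y - x0) *\<^sub>R f' x0 \<omega>) \<le> C * norm (y - x0)"
      using mult_right_mono[OF C(2), of "norm (y - x0)"] by (simp add: mult.commute)
    ultimately have "norm (f y \<omega> - f x0 \<omega> - (y - x0) *\<^sub>R f' x0 \<omega>) \<le> C * norm (y - x0) + C * norm (y - x0)"
      using norm_triangle_ineq4[of "f y \<omega> - f x0 \<omega>" "(y - x0) *\<^sub>R f' x0 \<omega>"] by linarith
    moreover have "norm (R y \<omega>) = norm (f y \<omega> - f x0 \<omega> - (y - x0) *\<^sub>R f' x0 \<omega>) / norm (y - x0)"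
      unfolding R_def by (simp only: norm_scaleR) (simp add: divide_inverse mult.commute)
    moreover have "0 < norm (y - x0)" using y by simp
    ultimately show ?thesis by (simp only: pos_divide_le_eq mult_2 distrib_right)
  qed
  have int_R: "integrable M (R y)" for y
    unfolding R_def by (intro integrable_scaleR_right Bochner_Integration.integrable_diff int)
  have lim_int: "((\<lambda>y. \<integral>\<omega>. R y \<omega> \<partial>M) \<longlongrightarrow> 0) (at x0 within S)"
    unfolding tendsto_at_iff_sequentially
  proof (intro allI impI)
    fix X assume X: "\<forall>i. X i \<in> S - {x0}" "X \<longlonglongrightarrow> x0"
    have "(\<lambda>i. \<integral>\<omega>. R (X i) \<omega> \<partial>M) \<longlonglongrightarrow> (\<integral>\<omega>. 0 \<partial>M)"
    proof (rule integral_dominated_convergence[where w = "\<lambda>_. 2 * C"])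
      show "AE \<omega> in M. (\<lambda>i. R (X i) \<omega>) \<longlonglongrightarrow> 0"
      proof (rule AE_I2)
        show "(\<lambda>i. R (X i) \<omega>) \<longlonglongrightarrow> 0" if "\<omega> \<in> space M" for \<omega>
          using lim_R[OF that, unfolded tendsto_at_iff_sequentially, rule_format, OF X(1)[rule_format] X(2)]
          by (simp only: o_def)
      qed
      show "AE \<omega> in M. norm (R (X i) \<omega>) \<le> 2 * C" for i
        by (rule AE_I2) (use bound_R X(1) in blast)
    qed (intro borel_measurable_const borel_measurable_integrable int_R integrable_const)+
    then show "((\<lambda>y. \<integral>\<omega>. R y \<omega> \<partial>M) \<circ> X) \<longlonglongrightarrow> 0" by (simp add: o_def)
  qed
  have int_eq: "(\<integral>\<omega>. R y \<omega> \<partial>M) =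
     ((\<integral>\<omega>. f y \<omega> \<partial>M) - (\<integral>\<omega>. f x0 \<omega> \<partial>M) - (y - x0) *\<^sub>R (\<integral>\<omega>. f' x0 \<omega> \<partial>M)) /\<^sub>R norm (y - x0)" for y
    unfolding R_def
    by (simp only: integral_scaleR_right Bochner_Integration.integral_diff int
        Bochner_Integration.integrable_diff integrable_scaleR_right)
  have "((\<lambda>x. \<integral>\<omega>. f x \<omega> \<partial>M) has_vector_derivative (\<integral>\<omega>. f' x0 \<omega> \<partial>M)) (at x0 within S)"
    unfolding has_vector_derivative_def has_derivative_at_within
    using lim_int[unfolded int_eq] bounded_linear_scaleR_left by blast
  moreover have "at x0 within S = at x0"
    using x0 by (rule at_within_open) (simp add: S_def)
  ultimately show ?thesis by (simp only:)
qed

subsection \<open>Haar measure on the unitary group\<close>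

lemma conj_transpose_nth [simp]: "conj_transpose A $ i $ j = cnj (A $ j $ i)"
  by (simp add: conj_transpose_def)

lemma conj_transpose_mult: "conj_transpose (A ** B) = conj_transpose B ** conj_transpose A"
  by (simp add: vec_eq_iff matrix_matrix_mult_def mult.commute)

lemma conj_transpose_conj_transpose [simp]: "conj_transpose (conj_transpose A) = A"
  by (simp add: vec_eq_iff)

lemma unitary_conj_transpose: "U \<in> unitary_group \<Longrightarrow> conj_transpose U \<in> unitary_group"
  by (auto simp: unitary_group_def)

lemma unitary_mult:
  assumes "U \<in> unitary_group" "V \<in> unitary_group"
  shows "U ** V \<in> unitary_group"
proof -
  have "conj_transpose V ** (conj_transpose U ** U) ** V = mat 1"
    "U ** (V ** conj_transpose V) ** conj_transpose U = mat 1"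
    using assms by (simp_all add: unitary_group_def)
  then show ?thesis
    by (simp add: unitary_group_def conj_transpose_mult matrix_mul_assoc)
qed

lemma continuous_on_matrix_mult [continuous_intros]:
  fixes f g :: "'a::topological_space \<Rightarrow> complex ^ 'n ^ 'n"
  shows "continuous_on S f \<Longrightarrow> continuous_on S g \<Longrightarrow> continuous_on S (\<lambda>x. f x ** g x)"
  unfolding matrix_matrix_mult_def by (intro continuous_intros)

lemma continuous_on_conj_transpose [continuous_intros]:
  fixes f :: "'a::topological_space \<Rightarrow> complex ^ 'n ^ 'n"
  shows "continuous_on S f \<Longrightarrow> continuous_on S (\<lambda>x. conj_transpose (f x))"
  unfolding conj_transpose_def by (intro continuous_intros)

lemma continuous_on_det [continuous_intros]:
  fixes f :: "'a::topological_space \<Rightarrow> complex ^ 'n ^ 'n"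
  shows "continuous_on S f \<Longrightarrow> continuous_on S (\<lambda>x. det (f x))"
  unfolding det_def by (intro continuous_intros)

locale haar_unitary =
  fixes \<kappa> :: "(complex ^ 'n ^ 'n) measure"
  assumes haar: "normalized_haar_unitary \<kappa>"
begin

sublocale prob_space \<kappa>
  using haar by (simp add: normalized_haar_unitary_def)

lemma space_haar: "space \<kappa> = unitary_group"
  using haar by (simp add: normalized_haar_unitary_def)

lemma sets_haar: "sets \<kappa> = sets (restrict_space borel unitary_group)"
  using haar by (simp add: normalized_haar_unitary_def)

lemma measurable_haar:
  fixes f :: "_ \<Rightarrow> 'b::topological_space"
  assumes "continuous_on unitary_group f"
  shows "f \<in> borel_measurable \<kappa>"
  using borel_measurable_continuous_on_restrict[OF assms] measurable_cong_sets[OF sets_haar refl]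
  by blast

lemma bounded_on_unitary:
  fixes f :: "complex ^ 'n ^ 'n \<Rightarrow> complex"
  assumes "continuous_on unitary_group f"
  obtains C where "\<And>U. U \<in> unitary_group \<Longrightarrow> norm (f U) \<le> C"
proof -
  have "bounded (f ` unitary_group)"
    by (intro compact_imp_bounded compact_continuous_image assms compact_unitary_group)
  then show ?thesis using that by (auto simp: bounded_iff)
qed

lemma integrable_haar:
  fixes f :: "complex ^ 'n ^ 'n \<Rightarrow> complex"
  assumes "continuous_on unitary_group f"
  shows "integrable \<kappa> f"
proof -
  obtain C where "\<And>U. U \<in> unitary_group \<Longrightarrow> norm (f U) \<le> C"
    using bounded_on_unitary[OF assms] by blast
  then show ?thesis
    by (intro integrable_const_bound[where B = C] measurable_haar assms) (auto simp: space_haar)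
qed

lemma measurable_id_haar: "(\<lambda>U. U) \<in> borel_measurable \<kappa>"
  by (intro measurable_haar continuous_intros)

lemma measurable_mult_left:
  assumes "V \<in> unitary_group"
  shows "(\<lambda>U. V ** U) \<in> measurable \<kappa> \<kappa>"
proof -
  have "(\<lambda>U. V ** U) \<in> measurable \<kappa> (restrict_space borel unitary_group)"
    by (rule measurable_restrict_space2)
       (use assms in \<open>auto simp: space_haar intro!: unitary_mult measurable_haar continuous_on_matrix_mult
         continuous_on_const continuous_on_id\<close>)
  then show ?thesis using measurable_cong_sets[OF refl sets_haar] by blast
qed

lemma integral_mult_left:
  fixes f :: "complex ^ 'n ^ 'n \<Rightarrow> complex"
  assumes "V \<in> unitary_group" "continuous_on unitary_group f"
  shows "(\<integral>U. f (V ** U) \<partial>\<kappa>) = (\<integral>U. f U \<partial>\<kappa>)"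
  using integral_distr[OF measurable_mult_left[OF assms(1)] measurable_haar[OF assms(2)]] haar assms(1)
  by (simp add: normalized_haar_unitary_def)

text \<open>Integrate \<open>f (V\<^sup>* U)\<close> over both variables: left invariance in \<open>U\<close> gives one side, and left
  invariance in \<open>V\<close>, after replacing \<open>V\<close> by \<open>U V\<close>, gives the other.\<close>

lemma integral_inverse:
  fixes f :: "complex ^ 'n ^ 'n \<Rightarrow> complex"
  assumes f: "continuous_on unitary_group f"
  shows "(\<integral>U. f (conj_transpose U) \<partial>\<kappa>) = (\<integral>U. f U \<partial>\<kappa>)"
proof -
  interpret pair: pair_prob_space \<kappa> \<kappa> ..
  define g :: "complex ^ 'n ^ 'n \<Rightarrow> complex ^ 'n ^ 'n \<Rightarrow> complex" where "g = (\<lambda>V U. f (conj_transpose V ** U))"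
  \<comment> \<open>Joint measurability, required for Fubini: the map is continuous on pairs of
    matrices, and its values on pairs of unitaries stay in the group.\<close>
  have meas: "(\<lambda>p. conj_transpose (fst p) ** snd p) \<in> measurable (\<kappa> \<Otimes>\<^sub>M \<kappa>) \<kappa>"
  proof -
    have "(\<lambda>p. conj_transpose (fst p) ** snd p) \<in> borel_measurable (\<kappa> \<Otimes>\<^sub>M \<kappa>)"
    proof (rule borel_measurable_continuous_Pair[where H = "\<lambda>V U. conj_transpose V ** U"])
      show "continuous_on UNIV (\<lambda>p :: (complex ^ 'n ^ 'n) \<times> (complex ^ 'n ^ 'n). conj_transpose (fst p) ** snd p)"
        by (intro continuous_intros)
    qed (rule measurable_compose[OF measurable_fst measurable_id_haar]
        measurable_compose[OF measurable_snd measurable_id_haar])+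
    then have "(\<lambda>p. conj_transpose (fst p) ** snd p) \<in> measurable (\<kappa> \<Otimes>\<^sub>M \<kappa>) (restrict_space borel unitary_group)"
      by (intro measurable_restrict_space2)
         (auto simp: space_pair_measure space_haar intro!: unitary_mult unitary_conj_transpose)
    then show ?thesis using measurable_cong_sets[OF refl sets_haar] by blast
  qed
  obtain C where C: "\<And>U. U \<in> unitary_group \<Longrightarrow> norm (f U) \<le> C"
    using bounded_on_unitary[OF f] by blast
  have int: "integrable (\<kappa> \<Otimes>\<^sub>M \<kappa>) (case_prod g)"
  proof (rule pair.integrable_const_bound[where B = C])
    show "case_prod g \<in> borel_measurable (\<kappa> \<Otimes>\<^sub>M \<kappa>)"
      using measurable_compose[OF meas measurable_haar[OF f]] by (simp add: g_def case_prod_beta')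
    show "AE p in \<kappa> \<Otimes>\<^sub>M \<kappa>. norm (case_prod g p) \<le> C"
      by (rule AE_I2)
         (auto simp: g_def space_pair_measure space_haar intro!: C unitary_mult unitary_conj_transpose)
  qed
  have inner: "(\<integral>U. g V U \<partial>\<kappa>) = (\<integral>U. f U \<partial>\<kappa>)" if "V \<in> unitary_group" for V
    unfolding g_def by (intro integral_mult_left f unitary_conj_transpose that)
  have cont_g: "continuous_on unitary_group (\<lambda>V. g V U)" if "U \<in> unitary_group" for U
    unfolding g_def
    by (rule continuous_on_compose2[OF f])
       (use that in \<open>auto intro!: continuous_on_matrix_mult continuous_on_conj_transpose
         continuous_on_const continuous_on_id unitary_mult unitary_conj_transpose\<close>)
  have outer: "(\<integral>V. g V U \<partial>\<kappa>) = (\<integral>V. f (conj_transpose V) \<partial>\<kappa>)" if U: "U \<in> unitary_group" for U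
  proof -
    have "(\<integral>V. g V U \<partial>\<kappa>) = (\<integral>V. g (U ** V) U \<partial>\<kappa>)"
      using integral_mult_left[OF U cont_g[OF U]] by simp
    also have "\<dots> = (\<integral>V. f (conj_transpose V) \<partial>\<kappa>)"
      using U by (simp add: g_def conj_transpose_mult unitary_group_def flip: matrix_mul_assoc)
    finally show ?thesis .
  qed
  have "(\<integral>V. f (conj_transpose V) \<partial>\<kappa>) = (\<integral>U. (\<integral>V. f (conj_transpose V) \<partial>\<kappa>) \<partial>\<kappa>)"
    by (simp add: prob_space)
  also have "\<dots> = (\<integral>U. (\<integral>V. g V U \<partial>\<kappa>) \<partial>\<kappa>)"
    by (rule Bochner_Integration.integral_cong) (simp_all add: space_haar outer)
  also have "\<dots> = (\<integral>V. (\<integral>U. g V U \<partial>\<kappa>) \<partial>\<kappa>)"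
    using pair.Fubini_integral[OF int] .
  also have "\<dots> = (\<integral>V. (\<integral>U. f U \<partial>\<kappa>) \<partial>\<kappa>)"
    by (rule Bochner_Integration.integral_cong) (simp_all add: space_haar inner)
  also have "\<dots> = (\<integral>U. f U \<partial>\<kappa>)"
    by (simp add: prob_space)
  finally show ?thesis .
qed

end

subsection \<open>Rotations and the Schwinger--Dyson equation\<close>

lemma matrix_mult_nth: "(A ** B) $ i $ j = (\<Sum>k\<in>UNIV. A $ i $ k * B $ k $ j)"
  by (simp add: matrix_matrix_mult_def)

lemma matrix_mult_minus_left: "(- A) ** B = - (A ** (B :: complex ^ 'n ^ 'n))"
  by (simp add: vec_eq_iff matrix_mult_nth sum_negf)

lemma matrix_mult_minus_right: "A ** (- B) = - (A ** (B :: complex ^ 'n ^ 'n))"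
  by (simp add: vec_eq_iff matrix_mult_nth sum_negf)

lemma matrix_mult_add_left: "(A + B) ** C = A ** C + B ** (C :: complex ^ 'n ^ 'n)"
  by (simp add: vec_eq_iff matrix_mult_nth distrib_right sum.distrib)

lemma matrix_mult_scaleR_left: "(c *\<^sub>R A) ** B = c *\<^sub>R (A ** (B :: complex ^ 'n ^ 'n))"
  by (simp add: vec_eq_iff matrix_mult_nth scaleR_sum_right)

lemma matrix_mult_scaleR_right: "A ** (c *\<^sub>R B) = c *\<^sub>R (A ** (B :: complex ^ 'n ^ 'n))"
  by (simp add: vec_eq_iff matrix_mult_nth scaleR_sum_right)

lemma has_vector_derivative_matrix_mult:
  fixes M N :: "real \<Rightarrow> complex ^ 'n ^ 'n"
  assumes "\<And>r c. ((\<lambda>s. M s $ r $ c) has_vector_derivative M' $ r $ c) (at x)"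
    and "\<And>r c. ((\<lambda>s. N s $ r $ c) has_vector_derivative N' $ r $ c) (at x)"
  shows "((\<lambda>s. (M s ** N s) $ r $ c) has_vector_derivative (M' ** N x + M x ** N') $ r $ c) (at x)"
proof -
  have "((\<lambda>s. \<Sum>k\<in>UNIV. M s $ r $ k * N s $ k $ c) has_vector_derivative
     (\<Sum>k\<in>UNIV. M x $ r $ k * N' $ k $ c + M' $ r $ k * N x $ k $ c)) (at x)"
    by (intro has_vector_derivative_sum has_vector_derivative_mult assms)
  then show ?thesis by (simp add: matrix_mult_nth sum.distrib add.commute)
qed

text \<open>If \<open>K\<^sup>3 = - K\<close> then this is the exponential of \<open>s K\<close>.\<close>

definition rotation :: "complex ^ 'n ^ 'n \<Rightarrow> real \<Rightarrow> complex ^ 'n ^ 'n" where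
  "rotation K s = mat 1 + (1 - cos s) *\<^sub>R (K ** K) + sin s *\<^sub>R K"

lemma rotation_0 [simp]: "rotation K 0 = mat 1"
  by (simp add: rotation_def)

context
  fixes K :: "complex ^ 'n ^ 'n"
  assumes skew: "conj_transpose K = - K" and cube: "K ** K ** K = - K"
begin

text \<open>The adjoint of \<open>rotation K s\<close> is \<open>rotation K (- s)\<close>, and the
  two multiply to the identity by the cubic relation for \<open>K\<close> and the Pythagorean
  identity.\<close>

lemma rotation_unitary: "rotation K s \<in> unitary_group"
proof -
  define P where "P = K ** K"
  have P_ct: "conj_transpose P = P"
    by (simp only: P_def conj_transpose_mult skew matrix_mult_minus_left matrix_mult_minus_right minus_minus)
  have KP: "K ** P = - K" "P ** K = - K"
    using cube by (simp_all only: P_def matrix_mul_assoc)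
  have PP: "P ** P = - P"
    using KP(2) by (simp only: P_def matrix_mul_assoc matrix_mult_minus_left)
  have KK: "K ** K = P" by (simp only: P_def)
  have ct: "conj_transpose (rotation K s) = rotation K (- s)"
  proof -
    have "cnj (K $ j $ i) = - K $ i $ j" "cnj (P $ j $ i) = P $ i $ j" for i j
      using arg_cong[OF skew, of "\<lambda>M. M $ i $ j"] arg_cong[OF P_ct, of "\<lambda>M. M $ i $ j"] by simp_all
    then show ?thesis
      by (simp add: rotation_def KK vec_eq_iff mat_def)
  qed
  have prod: "rotation K s ** rotation K (- s) = mat 1" for s
  proof -
    have sq: "sin s * sin s = 1 - cos s * cos s"
      using sin_cos_squared_add[of s] by (simp add: power2_eq_square)
    show ?thesis
      unfolding rotation_def KK
      by (simp only: matrix_add_ldistrib matrix_mult_add_left matrix_mult_scaleR_left matrix_mult_scaleR_right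
          matrix_mult_minus_left matrix_mult_minus_right KP PP KK matrix_mul_lid matrix_mul_rid
          cos_minus sin_minus)
         (simp add: sq algebra_simps)
  qed
  show ?thesis
    using prod[of s] prod[of "- s"] by (simp add: unitary_group_def ct)
qed

lemma has_vector_derivative_rotation:
  "((\<lambda>s. rotation K s $ r $ c) has_vector_derivative (K ** rotation K s) $ r $ c) (at s)"
proof -
  have K3: "K ** (K ** K) = - K" using cube by (simp add: matrix_mul_assoc)
  have "((\<lambda>s. mat 1 $ r $ c + (1 - cos s) *\<^sub>R (K ** K) $ r $ c + sin s *\<^sub>R K $ r $ c) has_vector_derivative
      sin s *\<^sub>R (K ** K) $ r $ c + cos s *\<^sub>R K $ r $ c) (at s)"
    by (auto intro!: derivative_eq_intros)
  moreover have "K ** rotation K s = sin s *\<^sub>R (K ** K) + cos s *\<^sub>R K"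
    unfolding rotation_def
    by (simp only: matrix_add_ldistrib matrix_mult_scaleR_right matrix_mul_rid K3) (simp add: algebra_simps)
  ultimately show ?thesis by (simp add: rotation_def)
qed

text \<open>Product rule; skewness of \<open>K\<close> turns the derivative of the adjoint factor
  into \<open>- X s ** K\<close>, so conjugates of \<open>A\<close> move with velocity the
  commutator of \<open>K\<close> and \<open>X s\<close>.\<close>

lemma has_vector_derivative_rotation_conjugate:
  fixes U A :: "complex ^ 'n ^ 'n"
  defines "X \<equiv> \<lambda>s. (rotation K s ** U) ** A ** conj_transpose (rotation K s ** U)"
  shows "((\<lambda>s. X s $ r $ c) has_vector_derivative (K ** X s - X s ** K) $ r $ c) (at s)"
proof -
  define W where "W = (\<lambda>s. rotation K s ** U)"
  have W: "((\<lambda>s. W s $ r $ c) has_vector_derivative (K ** W s) $ r $ c) (at s)" for r c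
    using has_vector_derivative_matrix_mult[OF has_vector_derivative_rotation, of "\<lambda>_. U" 0 s r c]
    by (simp add: W_def matrix_mul_assoc)
  have W_ct: "((\<lambda>s. conj_transpose (W s) $ r $ c) has_vector_derivative conj_transpose (K ** W s) $ r $ c) (at s)" for r c
    using has_vector_derivative_cnj[OF W] by simp
  have WA: "((\<lambda>s. (W s ** A) $ r $ c) has_vector_derivative (K ** W s ** A) $ r $ c) (at s)" for r c
    using has_vector_derivative_matrix_mult[OF W, of "\<lambda>_. A" 0 r c] by simp
  have "((\<lambda>s. (W s ** A ** conj_transpose (W s)) $ r $ c) has_vector_derivative
      (K ** W s ** A ** conj_transpose (W s) + W s ** A ** conj_transpose (K ** W s)) $ r $ c) (at s)"
    by (rule has_vector_derivative_matrix_mult[OF WA W_ct])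
  then show ?thesis
    by (simp add: X_def W_def conj_transpose_mult skew matrix_mult_minus_right matrix_mul_assoc)
qed

end

section \<open>Continuity of row replacement and of \<open>char_minor\<close>\<close>

lemma continuous_on_set_row [continuous_intros]:
  fixes f :: "'a::topological_space \<Rightarrow> complex ^ 'n ^ 'n"
  assumes "continuous_on S f" "continuous_on S g"
  shows "continuous_on S (\<lambda>x. set_row (f x) r (g x))"
  unfolding set_row_def
proof (rule continuous_on_vec_lambda)
  show "continuous_on S (\<lambda>x. if i = r then g x else f x $ i)" for i
    by (cases "i = r") (simp_all add: assms continuous_on_component)
qed

lemma continuous_on_char_minor [continuous_intros]:
  fixes f :: "'a::topological_space \<Rightarrow> complex ^ 'n ^ 'n"
  assumes "continuous_on S f"
  shows "continuous_on S (\<lambda>x. char_minor I (f x) c)"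
  unfolding char_minor_def
proof (rule continuous_on_vec_lambda)
  show "continuous_on S (\<lambda>x. if r \<in> I then c *s axis r 1 - f x $ r else axis r 1)" for r
    by (cases "r \<in> I") (simp_all add: assms continuous_on_component continuous_on_diff continuous_on_const)
qed

context haar_unitary
begin

text \<open>Infinitesimal left invariance: the integral of \<open>\<phi> (rotation K s ** U)\<close>
  is constant in \<open>s\<close>, and its derivative at \<open>0\<close> is the integral of
  \<open>\<psi>\<close>. This is the integration by parts used below.\<close>

lemma integral_rotation_derivative_eq_0:
  fixes \<phi> \<psi> :: "complex ^ 'n ^ 'n \<Rightarrow> complex"
  assumes skew: "conj_transpose K = - K" and cube: "K ** K ** K = - K"
    and cont: "continuous_on unitary_group \<phi>" "continuous_on unitary_group \<psi>"
    and deriv: "\<And>U s. U \<in> unitary_group \<Longrightarrow>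
      ((\<lambda>s. \<phi> (rotation K s ** U)) has_vector_derivative \<psi> (rotation K s ** U)) (at s)"
  shows "(\<integral>U. \<psi> U \<partial>\<kappa>) = 0"
proof -
  note rot = rotation_unitary[OF skew cube]
  obtain C where C: "\<And>U. U \<in> unitary_group \<Longrightarrow> norm (\<psi> U) \<le> C"
    using bounded_on_unitary[OF cont(2)] by blast
  have "((\<lambda>s. \<integral>U. \<phi> (rotation K s ** U) \<partial>\<kappa>) has_vector_derivative (\<integral>U. \<psi> (rotation K 0 ** U) \<partial>\<kappa>)) (at 0)"
  proof (rule has_vector_derivative_integral[where C = C])
    show "integrable \<kappa> (\<lambda>U. \<phi> (rotation K s ** U))" for s
      by (intro integrable_haar continuous_on_compose2[OF cont(1)])
         (auto intro!: continuous_intros unitary_mult rot)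
  qed (auto simp: space_haar intro!: deriv C unitary_mult rot integrable_haar cont finite_measure_axioms)
  then have "((\<lambda>s. \<integral>U. \<phi> U \<partial>\<kappa>) has_vector_derivative (\<integral>U. \<psi> U \<partial>\<kappa>)) (at (0::real))"
    by (simp add: integral_mult_left[OF rot cont(1)])
  then show ?thesis
    using vector_derivative_unique_at has_vector_derivative_const by blast
qed

text \<open>An unnormalized expectation over the unitary orbit of \<open>A\<close>. The constant
  function 1 for \<open>\<phi>\<close> gives the HCIZ integral with \<open>B\<close> diagonalized;
  keeping the eigenvalues as a function \<open>\<beta>\<close> allows one of them to vary.\<close>

definition weighted_avg :: "complex ^ 'n ^ 'n \<Rightarrow> complex \<Rightarrow> ('n \<Rightarrow> complex) \<Rightarrow> (complex ^ 'n ^ 'n \<Rightarrow> complex) \<Rightarrow> complex" where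
  "weighted_avg A \<tau> \<beta> \<phi> =
     (\<integral>U. \<phi> (U ** A ** conj_transpose U) * exp (\<tau> * (\<Sum>l\<in>UNIV. \<beta> l * (U ** A ** conj_transpose U) $ l $ l)) \<partial>\<kappa>)"

lemma continuous_weighted:
  assumes "continuous_on UNIV \<phi>"
  shows "continuous_on S (\<lambda>U. \<phi> (U ** A ** conj_transpose U)
     * exp (\<tau> * (\<Sum>l\<in>UNIV. \<beta> l * (U ** A ** conj_transpose (U :: complex ^ 'n ^ 'n)) $ l $ l)))"
  by (intro continuous_intros continuous_on_compose2[OF assms]) auto

lemma integrable_weighted:
  assumes "continuous_on UNIV \<phi>"
  shows "integrable \<kappa> (\<lambda>U. \<phi> (U ** A ** conj_transpose U)
     * exp (\<tau> * (\<Sum>l\<in>UNIV. \<beta> l * (U ** A ** conj_transpose U) $ l $ l)))"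
  by (intro integrable_haar continuous_weighted assms)

lemma weighted_avg_diff:
  assumes "continuous_on UNIV \<phi>" "continuous_on UNIV \<psi>"
  shows "weighted_avg A \<tau> \<beta> (\<lambda>X. \<phi> X - \<psi> X) = weighted_avg A \<tau> \<beta> \<phi> - weighted_avg A \<tau> \<beta> \<psi>"
  unfolding weighted_avg_def left_diff_distrib
  by (rule Bochner_Integration.integral_diff) (intro integrable_weighted assms)+

lemma weighted_avg_sum:
  assumes "\<And>i. i \<in> I \<Longrightarrow> continuous_on UNIV (\<phi> i)"
  shows "weighted_avg A \<tau> \<beta> (\<lambda>X. \<Sum>i\<in>I. \<phi> i X) = (\<Sum>i\<in>I. weighted_avg A \<tau> \<beta> (\<phi> i))"
  unfolding weighted_avg_def sum_distrib_right
  by (rule Bochner_Integration.integral_sum) (intro integrable_weighted assms)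

lemma weighted_avg_cmult: "weighted_avg A \<tau> \<beta> (\<lambda>X. c * \<phi> X) = c * weighted_avg A \<tau> \<beta> \<phi>"
  by (simp add: weighted_avg_def mult.assoc)

text \<open>Integration by parts for the determinant on the left, in the direction of the matrix
  unit at \<open>(j, p)\<close>. Differentiating the weight gives
  \<open>\<tau> * (\<beta> p - \<beta> j) * X $ p $ j\<close> up to sign; differentiating the
  determinant gives a difference of two minors by \<open>det_char_minor_variation\<close>.\<close>

lemma schwinger_dyson:
  fixes A :: "complex ^ 'n ^ 'n"
  assumes "p \<notin> J" "j \<in> J"
  shows "\<tau> * (\<beta> p - \<beta> j) * weighted_avg A \<tau> \<beta> (\<lambda>X. X $ p $ j * det (set_row (char_minor J X c) p (axis j 1)))
    = weighted_avg A \<tau> \<beta> (\<lambda>X. det (char_minor J X c))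
      - weighted_avg A \<tau> \<beta> (\<lambda>X. det (char_minor (insert p (J - {j})) X c))"
proof -
  have pj: "p \<noteq> j" using assms by auto
  define C where "C X = set_row (char_minor J X c) p (axis j 1)" for X
  \<comment> \<open>The derivative of \<open>det (C X)\<close> times the weight, divided by the
    weight, when \<open>X\<close> moves with velocity \<open>Y\<close>. Only the rows of
    \<open>C X\<close> in \<open>J\<close> depend on \<open>X\<close>, through
    \<open>- X $ r\<close>.\<close>
  define L where "L Y X = (\<Sum>r\<in>J. det (set_row (C X) r (- Y $ r)))
    + det (C X) * (\<tau> * (\<Sum>l\<in>UNIV. \<beta> l * Y $ l $ l))" for Y X :: "complex ^ 'n ^ 'n"
  \<comment> \<open>The commutator of the matrix unit at \<open>(a, b)\<close> with
    \<open>X\<close>.\<close>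
  define Y where "Y a b X = (\<chi> r. (if r = a then X $ b else 0) - X $ r $ a *s axis b 1)"
    for a b and X :: "complex ^ 'n ^ 'n"
  have cont_C: "continuous_on UNIV C"
    unfolding C_def by (intro continuous_intros)
  have cont_Y: "continuous_on UNIV (Y a b)" for a b
  proof -
    have "continuous_on UNIV (\<lambda>X. Y a b X $ r $ s)" for r s
      by (cases "r = a"; cases "s = b") (auto simp: Y_def axis_def intro!: continuous_intros)
    then have "continuous_on UNIV (\<lambda>X. \<chi> r s. Y a b X $ r $ s)"
      by (intro continuous_on_vec_lambda)
    then show ?thesis by simp
  qed
  have cont_L: "continuous_on UNIV (\<lambda>X. L (f X) X)" if "continuous_on UNIV f" for f
    unfolding L_def by (intro continuous_intros cont_C that)
  have L_lin: "L (\<chi> r. u *s Y1 $ r - v *s Y2 $ r) X = u * L Y1 X - v * L Y2 X" for u v Y1 Y2 X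
  proof -
    have *: "- (u *s Y1 $ r - v *s Y2 $ r) = u *s (- Y1 $ r) - v *s (- Y2 $ r)" for r
      by (simp add: vec_eq_iff)
    show ?thesis
      unfolding L_def
      by (simp add: * det_set_row_diff det_set_row_scale det_set_row_minus sum_negf sum_subtractf sum_distrib_left algebra_simps)
  qed
  \<comment> \<open>A matrix unit off the diagonal is not skew-Hermitian. The combination
    \<open>K\<close> of the units at \<open>(j, p)\<close> and \<open>(p, j)\<close> with
    coefficients \<open>w\<close> and \<open>- cnj w\<close> is, and \<open>w * cnj w = 1\<close>
    gives its cube \<open>- K\<close>.\<close>
  have main: "w * weighted_avg A \<tau> \<beta> (\<lambda>X. L (Y j p X) X) = cnj w * weighted_avg A \<tau> \<beta> (\<lambda>X. L (Y p j X) X)"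
    if w: "w * cnj w = 1" for w
  proof -
    define K :: "complex ^ 'n ^ 'n" where
      "K = (\<chi> r s. if r = j \<and> s = p then w else if r = p \<and> s = j then - cnj w else 0)"
    have left: "(K ** M) $ r = (if r = j then w *s M $ p else if r = p then - cnj w *s M $ j else 0)" for M r
    proof -
      have "(K ** M) $ r $ s = (\<Sum>k\<in>{p, j}. K $ r $ k * M $ k $ s)" for s
        unfolding matrix_mult_nth by (rule sum.mono_neutral_right) (auto simp: K_def)
      then show ?thesis using pj by (auto simp: vec_eq_iff K_def)
    qed
    have right: "(M ** K) $ r = (w * M $ r $ j) *s axis p 1 - (cnj w * M $ r $ p) *s axis j 1" for M r
    proof -
      have "(M ** K) $ r $ s = (\<Sum>k\<in>{p, j}. M $ r $ k * K $ k $ s)" for s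
        unfolding matrix_mult_nth by (rule sum.mono_neutral_right) (auto simp: K_def)
      then show ?thesis using pj by (auto simp: vec_eq_iff K_def axis_def)
    qed
    have skew: "conj_transpose K = - K"
      using pj by (auto simp: vec_eq_iff K_def)
    have cube: "K ** K ** K = - K"
    proof -
      have "(K ** (K ** K)) $ r = - K $ r" for r
        unfolding left using pj w
        by (auto simp: vec_eq_iff K_def mult.commute mult.assoc[symmetric])
      then show ?thesis by (simp add: vec_eq_iff matrix_mul_assoc)
    qed
    have comm: "K ** X - X ** K = (\<chi> r. w *s Y j p X $ r - cnj w *s Y p j X $ r)" for X
    proof -
      have "(K ** X - X ** K) $ r = w *s Y j p X $ r - cnj w *s Y p j X $ r" for r
        using pj by (auto simp: left right Y_def vec_eq_iff algebra_simps)
      then show ?thesis by (simp add: vec_eq_iff)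
    qed
    have "(\<integral>U. L (K ** (U ** A ** conj_transpose U) - (U ** A ** conj_transpose U) ** K) (U ** A ** conj_transpose U)
       * exp (\<tau> * (\<Sum>l\<in>UNIV. \<beta> l * (U ** A ** conj_transpose U) $ l $ l)) \<partial>\<kappa>) = 0"
    proof (rule integral_rotation_derivative_eq_0[OF skew cube])
      show "continuous_on unitary_group (\<lambda>U. det (C (U ** A ** conj_transpose U))
       * exp (\<tau> * (\<Sum>l\<in>UNIV. \<beta> l * (U ** A ** conj_transpose U) $ l $ l)))"
        by (rule continuous_weighted) (intro continuous_intros cont_C)
      show "continuous_on unitary_group (\<lambda>U. L (K ** (U ** A ** conj_transpose U) - (U ** A ** conj_transpose U) ** K) (U ** A ** conj_transpose U)
       * exp (\<tau> * (\<Sum>l\<in>UNIV. \<beta> l * (U ** A ** conj_transpose U) $ l $ l)))"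
        by (rule continuous_weighted[where \<phi> = "\<lambda>X. L (K ** X - X ** K) X"]) (intro cont_L continuous_intros)
      fix U :: "complex ^ 'n ^ 'n" and s :: real assume "U \<in> unitary_group"
      define X where "X s = (rotation K s ** U) ** A ** conj_transpose (rotation K s ** U)" for s
      define Z where "Z = K ** X s - X s ** K"
      have X: "((\<lambda>s. X s $ r $ t) has_vector_derivative Z $ r $ t) (at s)" for r t
        using has_vector_derivative_rotation_conjugate[OF skew cube] by (simp add: X_def Z_def)
      have "((\<lambda>s. C (X s) $ r $ t) has_vector_derivative (\<chi> r. if r \<in> J then - Z $ r else 0) $ r $ t) (at s)" for r t
      proof (cases "r \<in> J")
        case True
        then have "r \<noteq> p" using assms(1) by auto
        with True show ?thesis
          using has_vector_derivative_diff[OF has_vector_derivative_const[of "c * axis r 1 $ t"] X[of r t]]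
          by (simp add: C_def set_row_nth char_minor_nth)
      next
        case False
        then have "C (X s) $ r $ t = (if r = p then axis j 1 else axis r 1) $ t" for s
          by (simp add: C_def set_row_nth char_minor_nth)
        with False show ?thesis by simp
      qed
      then have "((\<lambda>s. det (C (X s))) has_vector_derivative
          (\<Sum>r\<in>UNIV. det (set_row (C (X s)) r ((\<chi> r. if r \<in> J then - Z $ r else 0) $ r)))) (at s)"
        by (rule has_vector_derivative_det)
      also have "(\<Sum>r\<in>UNIV. det (set_row (C (X s)) r ((\<chi> r. if r \<in> J then - Z $ r else 0) $ r)))
          = (\<Sum>r\<in>J. det (set_row (C (X s)) r (- Z $ r)))"
        by (rule sum.mono_neutral_cong_right) auto
      finally have det: "((\<lambda>s. det (C (X s))) has_vector_derivative
          (\<Sum>r\<in>J. det (set_row (C (X s)) r (- Z $ r)))) (at s)" .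
      have "((\<lambda>s. \<tau> * (\<Sum>l\<in>UNIV. \<beta> l * X s $ l $ l)) has_vector_derivative
          \<tau> * (\<Sum>l\<in>UNIV. \<beta> l * Z $ l $ l)) (at s)"
        by (intro has_vector_derivative_mult_right has_vector_derivative_sum X)
      then have "((exp \<circ> (\<lambda>s. \<tau> * (\<Sum>l\<in>UNIV. \<beta> l * X s $ l $ l))) has_vector_derivative
          \<tau> * (\<Sum>l\<in>UNIV. \<beta> l * Z $ l $ l) * exp (\<tau> * (\<Sum>l\<in>UNIV. \<beta> l * X s $ l $ l))) (at s)"
        by (rule field_vector_diff_chain_at) (auto intro!: derivative_eq_intros)
      from has_vector_derivative_mult[OF det this]
      show "((\<lambda>s. det (C ((rotation K s ** U) ** A ** conj_transpose (rotation K s ** U)))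
       * exp (\<tau> * (\<Sum>l\<in>UNIV. \<beta> l * ((rotation K s ** U) ** A ** conj_transpose (rotation K s ** U)) $ l $ l))) has_vector_derivative
         L (K ** ((rotation K s ** U) ** A ** conj_transpose (rotation K s ** U)) - ((rotation K s ** U) ** A ** conj_transpose (rotation K s ** U)) ** K)
           ((rotation K s ** U) ** A ** conj_transpose (rotation K s ** U))
       * exp (\<tau> * (\<Sum>l\<in>UNIV. \<beta> l * ((rotation K s ** U) ** A ** conj_transpose (rotation K s ** U)) $ l $ l))) (at s)"
        unfolding X_def[symmetric] Z_def[symmetric] by (simp add: L_def o_def algebra_simps)
    qed
    then have "0 = weighted_avg A \<tau> \<beta> (\<lambda>X. w * L (Y j p X) X - cnj w * L (Y p j X) X)"
      by (simp add: weighted_avg_def comm L_lin)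
    also have "\<dots> = weighted_avg A \<tau> \<beta> (\<lambda>X. w * L (Y j p X) X) - weighted_avg A \<tau> \<beta> (\<lambda>X. cnj w * L (Y p j X) X)"
      by (rule weighted_avg_diff) (intro continuous_intros cont_L cont_Y)+
    finally show ?thesis by (simp add: weighted_avg_cmult)
  qed
  \<comment> \<open>\<open>w = 1\<close> makes the two averages equal and \<open>w = \<i>\<close>
    makes them opposite, so both vanish: the direction of a single matrix unit is isolated.\<close>
  have "weighted_avg A \<tau> \<beta> (\<lambda>X. L (Y j p X) X) = 0"
    using main[of 1] main[of \<i>] by auto
  moreover have "L (Y j p X) X = det (char_minor J X c) - det (char_minor (insert p (J - {j})) X c)
      - \<tau> * (\<beta> p - \<beta> j) * (X $ p $ j * det (C X))" for X
  proof -
    have "(\<Sum>l\<in>UNIV. \<beta> l * Y j p X $ l $ l) = (\<Sum>l\<in>{p, j}. \<beta> l * Y j p X $ l $ l)"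
      by (rule sum.mono_neutral_right) (auto simp: Y_def axis_def)
    also have "\<dots> = (\<beta> j - \<beta> p) * X $ p $ j"
      using pj by (simp add: Y_def axis_def algebra_simps)
    finally have "(\<Sum>l\<in>UNIV. \<beta> l * Y j p X $ l $ l) = (\<beta> j - \<beta> p) * X $ p $ j" .
    moreover have "(\<Sum>r\<in>J. det (set_row (C X) r (- Y j p X $ r))) =
        det (char_minor J X c) - det (char_minor (insert p (J - {j})) X c)"
      unfolding C_def det_char_minor_variation[OF assms, symmetric] by (simp add: Y_def)
    ultimately show ?thesis by (simp only: L_def) (simp add: algebra_simps)
  qed
  ultimately have *: "weighted_avg A \<tau> \<beta> (\<lambda>X. det (char_minor J X c) - det (char_minor (insert p (J - {j})) X c)
      - \<tau> * (\<beta> p - \<beta> j) * (X $ p $ j * det (C X))) = 0" by simp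
  have cont: "continuous_on UNIV (\<lambda>X :: complex ^ 'n ^ 'n. det (char_minor I X c))" for I
    by (intro continuous_intros)
  have cont': "continuous_on UNIV (\<lambda>X. \<tau> * (\<beta> p - \<beta> j) * (X $ p $ j * det (C X)))"
    by (intro continuous_intros cont_C)
  from * show ?thesis
    unfolding weighted_avg_diff[OF continuous_on_diff[OF cont cont] cont'] weighted_avg_diff[OF cont cont]
      weighted_avg_cmult
    by (simp add: C_def)
qed

end

subsection \<open>Dependence on one eigenvalue\<close>

context haar_unitary
begin

text \<open>Differentiating the weight in the eigenvalue at \<open>p\<close> brings down the factor
  \<open>\<tau> * X $ p $ p\<close>.\<close>

lemma has_vector_derivative_weighted_avg:
  assumes \<phi>: "continuous_on UNIV \<phi>"
  shows "((\<lambda>x. weighted_avg A \<tau> (\<beta>(p := complex_of_real x)) \<phi>) has_vector_derivative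
      \<tau> * weighted_avg A \<tau> (\<beta>(p := complex_of_real x)) (\<lambda>X. X $ p $ p * \<phi> X)) (at x)"
proof -
  define X where "X U = U ** A ** conj_transpose U" for U :: "complex ^ 'n ^ 'n"
  define e where "e x U = exp (\<tau> * (\<Sum>l\<in>UNIV. (\<beta>(p := complex_of_real x)) l * X U $ l $ l))" for x U
  have cont_X: "continuous_on UNIV X"
    unfolding X_def by (intro continuous_intros)
  have cont_e: "continuous_on UNIV (\<lambda>z. e (fst z) (snd z))"
  proof -
    have "continuous_on UNIV (\<lambda>z. (\<beta>(p := complex_of_real (fst z))) l * X (snd z) $ l $ l)" for l
      by (cases "l = p") (auto intro!: continuous_intros continuous_on_compose2[OF cont_X])
    then show ?thesis
      unfolding e_def by (intro continuous_on_exp continuous_on_mult_left continuous_on_sum)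
  qed
  \<comment> \<open>Compactness of an interval around \<open>x\<close> times the unitary group
    supplies the constant dominating the derivative.\<close>
  have "compact ((\<lambda>z. \<phi> (X (snd z)) * (\<tau> * X (snd z) $ p $ p * e (fst z) (snd z))) ` (cball x 1 \<times> unitary_group))"
    by (intro compact_continuous_image compact_Times compact_cball compact_unitary_group continuous_intros
        continuous_on_compose2[OF \<phi>] continuous_on_compose2[OF cont_X] continuous_on_subset[OF cont_e] subset_UNIV)
  then obtain C where C: "\<And>y U. y \<in> cball x 1 \<Longrightarrow> U \<in> unitary_group \<Longrightarrow>
      norm (\<phi> (X U) * (\<tau> * X U $ p $ p * e y U)) \<le> C"
    by (force dest!: compact_imp_bounded simp: bounded_iff)
  have "((\<lambda>x. \<integral>U. \<phi> (X U) * e x U \<partial>\<kappa>) has_vector_derivative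
      (\<integral>U. \<phi> (X U) * (\<tau> * X U $ p $ p * e x U) \<partial>\<kappa>)) (at x)"
  proof (rule has_vector_derivative_integral[where C = C])
    show "finite_measure \<kappa>" by (rule finite_measure_axioms)
    show "integrable \<kappa> (\<lambda>U. \<phi> (X U) * e y U)" for y
      using integrable_weighted[OF \<phi>] by (simp add: X_def e_def)
    show "integrable \<kappa> (\<lambda>U. \<phi> (X U) * (\<tau> * X U $ p $ p * e x U))"
    proof -
      have "continuous_on UNIV (\<lambda>X :: complex ^ 'n ^ 'n. \<phi> X * (\<tau> * X $ p $ p))"
        by (intro continuous_intros \<phi>)
      from integrable_weighted[OF this] show ?thesis
        by (simp add: X_def e_def mult.assoc)
    qed
    show "norm (\<phi> (X U) * (\<tau> * X U $ p $ p * e y U)) \<le> C" if "U \<in> space \<kappa>" "\<bar>y - x\<bar> < 1" for y U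
      using that by (intro C) (auto simp: space_haar dist_real_def abs_minus_commute)
    show "((\<lambda>y. \<phi> (X U) * e y U) has_vector_derivative \<phi> (X U) * (\<tau> * X U $ p $ p * e y U)) (at y)" for y U
    proof (rule has_vector_derivative_mult_right)
      have sum: "(\<Sum>l\<in>UNIV. (\<beta>(p := complex_of_real y)) l * X U $ l $ l)
          = complex_of_real y * X U $ p $ p + (\<Sum>l\<in>UNIV - {p}. \<beta> l * X U $ l $ l)" for y
        by (simp add: sum.remove[of UNIV p])
      have "((\<lambda>y. \<tau> * (\<Sum>l\<in>UNIV. (\<beta>(p := complex_of_real y)) l * X U $ l $ l)) has_vector_derivative
          \<tau> * X U $ p $ p) (at y)"
        unfolding sum by (auto intro!: derivative_eq_intros)
      then have "((exp \<circ> (\<lambda>y. \<tau> * (\<Sum>l\<in>UNIV. (\<beta>(p := complex_of_real y)) l * X U $ l $ l))) has_vector_derivative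
          \<tau> * X U $ p $ p * e y U) (at y)"
        unfolding e_def by (rule field_vector_diff_chain_at) (auto intro!: derivative_eq_intros)
      then show "((\<lambda>y. e y U) has_vector_derivative \<tau> * X U $ p $ p * e y U) (at y)"
        by (simp add: e_def o_def)
    qed
  qed
  also have "(\<integral>U. \<phi> (X U) * (\<tau> * X U $ p $ p * e x U) \<partial>\<kappa>)
      = (\<integral>U. \<tau> * (X U $ p $ p * \<phi> (X U) * e x U) \<partial>\<kappa>)"
    by (simp add: mult_ac)
  also have "\<dots> = \<tau> * weighted_avg A \<tau> (\<beta>(p := complex_of_real x)) (\<lambda>X. X $ p $ p * \<phi> X)"
    by (simp add: weighted_avg_def X_def e_def)
  finally show ?thesis
    by (simp add: weighted_avg_def X_def e_def)
qed

text \<open>When \<open>J = - {p}\<close> the subtracted term is a multiple of the characteristic polynomial of \<open>A\<close>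
  at \<open>c\<close>, so at an eigenvalue \<open>c\<close> the equation reads \<open>H' = \<tau> c H\<close>. The induction removes the
  elements of \<open>J\<close> one by one, using the Schwinger--Dyson equation for each.\<close>

lemma weighted_char_minor_primitive:
  fixes A :: "complex ^ 'n ^ 'n" and \<beta> :: "'n \<Rightarrow> complex" and \<alpha> :: "'n \<Rightarrow> complex"
  assumes \<tau>: "\<tau> \<noteq> 0"
    and l: "\<And>q c. degree q < CARD('n) \<Longrightarrow> poly q c = (\<Sum>m\<in>UNIV. poly q (\<alpha> m) * l m c)"
    and J: "p \<notin> J"
  shows "\<exists>H. (\<forall>c x. (H c has_vector_derivative \<tau> * (c * H c x - (\<Prod>j\<in>J. complex_of_real x - \<beta> j)
            * weighted_avg A \<tau> (\<beta>(p := complex_of_real x)) (\<lambda>X. det (char_minor (insert p J) X c)))) (at x))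
      \<and> (\<forall>c x. H c x = (\<Sum>m\<in>UNIV. H (\<alpha> m) x * l m c))"
  using finite_class.finite[of J] J
proof (induction J rule: finite_psubset_induct)
  case (psubset J)
  define E where "E I c x = weighted_avg A \<tau> (\<beta>(p := complex_of_real x)) (\<lambda>X. det (char_minor I X c))" for I c x
  define P where "P J x = (\<Prod>j\<in>J. complex_of_real x - \<beta> j)" for J x
  have IH: "\<forall>j\<in>J. \<exists>H. (\<forall>c x. (H c has_vector_derivative \<tau> * (c * H c x - P (J - {j}) x * E (insert p (J - {j})) c x)) (at x))
      \<and> (\<forall>c x. H c x = (\<Sum>m\<in>UNIV. H (\<alpha> m) x * l m c))"
    unfolding P_def E_def using psubset.prems by (intro ballI psubset.IH) auto
  then obtain H where
      H: "\<And>j c x. j \<in> J \<Longrightarrow> (H j c has_vector_derivative \<tau> * (c * H j c x - P (J - {j}) x * E (insert p (J - {j})) c x)) (at x)"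
    and H_l: "\<And>j c x. j \<in> J \<Longrightarrow> H j c x = (\<Sum>m\<in>UNIV. H j (\<alpha> m) x * l m c)"
    using bchoice[OF IH] by blast
  have cont: "continuous_on UNIV (\<lambda>X :: complex ^ 'n ^ 'n. det (char_minor I X c))" for I c
    by (intro continuous_intros)
  have contC: "continuous_on UNIV (\<lambda>X :: complex ^ 'n ^ 'n. X $ p $ j * det (set_row (char_minor J X c) p (axis j 1)))" for j c
    by (intro continuous_intros)
  define D where "D c x = weighted_avg A \<tau> (\<beta>(p := complex_of_real x)) (\<lambda>X. X $ p $ p * det (char_minor J X c))" for c x
  define S where "S j c x = weighted_avg A \<tau> (\<beta>(p := complex_of_real x))
      (\<lambda>X. X $ p $ j * det (set_row (char_minor J X c) p (axis j 1)))" for j c x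
  have expand: "E (insert p J) c x = c * E J c x - D c x - (\<Sum>j\<in>J. S j c x)" for c x
  proof -
    have "E (insert p J) c x = weighted_avg A \<tau> (\<beta>(p := complex_of_real x))
       (\<lambda>X. c * det (char_minor J X c) - X $ p $ p * det (char_minor J X c)
          - (\<Sum>j\<in>J. X $ p $ j * det (set_row (char_minor J X c) p (axis j 1))))"
      unfolding E_def det_char_minor_insert[OF psubset.prems] by (simp add: left_diff_distrib)
    also have "\<dots> = weighted_avg A \<tau> (\<beta>(p := complex_of_real x)) (\<lambda>X. c * det (char_minor J X c) - X $ p $ p * det (char_minor J X c))
       - (\<Sum>j\<in>J. S j c x)"
      unfolding S_def weighted_avg_sum[OF contC, symmetric]
      by (rule weighted_avg_diff) (intro continuous_intros)+
    also have "weighted_avg A \<tau> (\<beta>(p := complex_of_real x)) (\<lambda>X. c * det (char_minor J X c) - X $ p $ p * det (char_minor J X c))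
       = c * E J c x - D c x"
      unfolding E_def D_def weighted_avg_cmult[symmetric]
      by (rule weighted_avg_diff) (intro continuous_intros)+
    finally show ?thesis .
  qed
  have dyson: "\<tau> * (complex_of_real x - \<beta> j) * S j c x = E J c x - E (insert p (J - {j})) c x" if "j \<in> J" for j c x
  proof -
    have "j \<noteq> p" using that psubset.prems by auto
    then show ?thesis
      using schwinger_dyson[OF psubset.prems that, of \<tau> "\<beta>(p := complex_of_real x)" A c]
      by (simp add: S_def E_def)
  qed
  \<comment> \<open>The witness. Differentiating \<open>P J x * E J c x\<close> produces the
    \<open>D\<close> term of \<open>expand\<close> and the terms
    \<open>P (J - {j}) x * E J c x\<close>. By \<open>dyson\<close> the latter give the
    \<open>S\<close> terms, up to multiples of \<open>E (insert p (J - {j})) c x\<close> that the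
    derivatives of the inductive primitives \<open>H j\<close> cancel; what remains of these
    derivatives completes \<open>c * G c x\<close>.\<close>
  define G where "G c x = P J x * E J c x + (\<Sum>j\<in>J. H j c x) / \<tau>" for c x
  show ?case
  proof (intro exI conjI allI)
    fix c x
    have dP: "(P J has_vector_derivative (\<Sum>j\<in>J. P (J - {j}) x)) (at x)"
    proof -
      have "((\<lambda>x. complex_of_real x - \<beta> j) has_vector_derivative 1) (at x)" for j
        by (auto intro!: derivative_eq_intros)
      from has_vector_derivative_prod[of J, OF this] show ?thesis
        by (simp add: P_def[abs_def])
    qed
    have dE: "(E J c has_vector_derivative \<tau> * D c x) (at x)"
      unfolding E_def[abs_def] D_def by (rule has_vector_derivative_weighted_avg[OF cont])
    have "(G c has_vector_derivative (P J x * (\<tau> * D c x) + (\<Sum>j\<in>J. P (J - {j}) x) * E J c x)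
        + (\<Sum>j\<in>J. \<tau> * (c * H j c x - P (J - {j}) x * E (insert p (J - {j})) c x)) / \<tau>) (at x)"
      unfolding G_def[abs_def]
      by (intro has_vector_derivative_add has_vector_derivative_mult has_vector_derivative_divide
          has_vector_derivative_sum dP dE H)
    also have "(P J x * (\<tau> * D c x) + (\<Sum>j\<in>J. P (J - {j}) x) * E J c x)
        + (\<Sum>j\<in>J. \<tau> * (c * H j c x - P (J - {j}) x * E (insert p (J - {j})) c x)) / \<tau>
      = \<tau> * (c * G c x - P J x * E (insert p J) c x)"
    proof -
      \<comment> \<open>Splitting off the factor at \<open>j\<close> makes the left-hand side of
        \<open>dyson\<close> appear.\<close>
      have split: "P J x = (complex_of_real x - \<beta> j) * P (J - {j}) x" if "j \<in> J" for j
        using that by (simp add: P_def prod.remove)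
      have "\<tau> * P J x * (\<Sum>j\<in>J. S j c x) = (\<Sum>j\<in>J. P (J - {j}) x * (\<tau> * (complex_of_real x - \<beta> j) * S j c x))"
        unfolding sum_distrib_left by (rule sum.cong) (simp_all add: split)
      also have "\<dots> = (\<Sum>j\<in>J. P (J - {j}) x * (E J c x - E (insert p (J - {j})) c x))"
        by (rule sum.cong) (simp_all add: dyson)
      also have "\<dots> = (\<Sum>j\<in>J. P (J - {j}) x) * E J c x - (\<Sum>j\<in>J. P (J - {j}) x * E (insert p (J - {j})) c x)"
        by (simp add: sum_distrib_right right_diff_distrib sum_subtractf)
      finally have S: "\<tau> * P J x * (\<Sum>j\<in>J. S j c x) = (\<Sum>j\<in>J. P (J - {j}) x) * E J c x
          - (\<Sum>j\<in>J. P (J - {j}) x * E (insert p (J - {j})) c x)" .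
      have sum: "(\<Sum>j\<in>J. \<tau> * (c * H j c x - P (J - {j}) x * E (insert p (J - {j})) c x)) / \<tau>
          = c * (\<Sum>j\<in>J. H j c x) - (\<Sum>j\<in>J. P (J - {j}) x * E (insert p (J - {j})) c x)"
        using \<tau> by (simp add: sum_distrib_left[symmetric] sum_subtractf)
      have rhs: "\<tau> * (c * G c x - P J x * E (insert p J) c x)
          = P J x * (\<tau> * D c x) + c * (\<Sum>j\<in>J. H j c x) + \<tau> * P J x * (\<Sum>j\<in>J. S j c x)"
        using \<tau> by (simp only: expand G_def) (simp add: algebra_simps)
      show ?thesis unfolding sum rhs S by (simp add: algebra_simps)
    qed
    finally show "(G c has_vector_derivative \<tau> * (c * G c x - (\<Prod>j\<in>J. complex_of_real x - \<beta> j)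
            * weighted_avg A \<tau> (\<beta>(p := complex_of_real x)) (\<lambda>X. det (char_minor (insert p J) X c)))) (at x)"
      unfolding P_def E_def .
    \<comment> \<open>Since \<open>J\<close> misses \<open>p\<close>, the minor has degree below
      \<open>CARD('n)\<close> in \<open>c\<close>, so interpolation applies before
      averaging.\<close>
    have E_l: "E J c x = (\<Sum>m\<in>UNIV. E J (\<alpha> m) x * l m c)"
    proof -
      have "det (char_minor J X c) = (\<Sum>m\<in>UNIV. l m c * det (char_minor J X (\<alpha> m)))" for X :: "complex ^ 'n ^ 'n"
      proof -
        obtain q where q: "degree q \<le> card J" "\<And>c. det (char_minor J X c) = poly q c"
          using degree_det_char_minor by blast
        have "card J < CARD('n)"
          using psubset.prems by (intro psubset_card_mono) auto
        then show ?thesis using l[of q c] q by (simp add: mult.commute)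
      qed
      then have "E J c x = weighted_avg A \<tau> (\<beta>(p := complex_of_real x)) (\<lambda>X. \<Sum>m\<in>UNIV. l m c * det (char_minor J X (\<alpha> m)))"
        by (simp add: E_def)
      also have "\<dots> = (\<Sum>m\<in>UNIV. l m c * E J (\<alpha> m) x)"
        unfolding E_def weighted_avg_cmult[symmetric] by (rule weighted_avg_sum) (intro continuous_intros)
      finally show ?thesis by (simp add: mult.commute)
    qed
    define T where "T c = (\<Sum>j\<in>J. H j c x)" for c
    have T_l: "T c = (\<Sum>m\<in>UNIV. T (\<alpha> m) * l m c)"
      unfolding T_def sum_distrib_right by (subst sum.swap) (intro sum.cong refl H_l)
    have G_T: "G c x = P J x * E J c x + T c / \<tau>" for c
      by (simp add: G_def T_def)
    show "G c x = (\<Sum>m\<in>UNIV. G (\<alpha> m) x * l m c)"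
      unfolding G_T E_l T_l by (simp add: sum_distrib_left sum_divide_distrib sum.distrib distrib_right mult.assoc)
  qed
qed

text \<open>The arithmetic progression and the choice of \<open>z\<close> are condensed into
  \<open>period\<close>: one multiplier \<open>\<rho>\<close> serves all nodes, so a shift of
  \<open>x\<close> by \<open>b p - b j\<close> acts on \<open>H c\<close> as multiplication by
  \<open>\<rho>\<close> for every \<open>c\<close>.\<close>

lemma weighted_avg_eq_0:
  fixes A :: "complex ^ 'n ^ 'n" and b :: "'n \<Rightarrow> real" and \<alpha> :: "'n \<Rightarrow> complex"
  assumes \<tau>: "\<tau> \<noteq> 0" and "inj \<alpha>" and b: "inj b" and pj: "p \<noteq> j"
    and char_poly: "\<And>U c. U \<in> unitary_group \<Longrightarrow>
      det (char_minor UNIV (U ** A ** conj_transpose U) c) = (\<Prod>m\<in>UNIV. c - \<alpha> m)"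
    and period: "\<And>m. exp (\<tau> * \<alpha> m * complex_of_real (b p - b j)) = \<rho>"
  shows "weighted_avg A \<tau> (\<lambda>m. complex_of_real (b m)) (\<lambda>_. 1) = 0"
proof -
  define \<beta> where "\<beta> m = complex_of_real (b m)" for m
  define F where "F x = weighted_avg A \<tau> (\<beta>(p := complex_of_real x)) (\<lambda>_. 1)" for x
  define P where "P x = (\<Prod>m\<in>- {p}. complex_of_real x - \<beta> m)" for x
  obtain l where l: "\<And>q c. degree q < CARD('n) \<Longrightarrow> poly q c = (\<Sum>m\<in>UNIV. poly q (\<alpha> m) * l m c)"
    using lagrange_interpolation[OF \<open>inj \<alpha>\<close>] by blast
  \<comment> \<open>The characteristic polynomial is constant on the orbit and leaves the
    average.\<close>
  have char_avg: "weighted_avg A \<tau> (\<beta>(p := complex_of_real x)) (\<lambda>X. det (char_minor UNIV X c)) = (\<Prod>m\<in>UNIV. c - \<alpha> m) * F x" for c x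
    unfolding F_def weighted_avg_cmult[symmetric] unfolding weighted_avg_def
    by (rule Bochner_Integration.integral_cong) (simp_all add: space_haar char_poly)
  have compl: "insert p (- {p}) = UNIV" "p \<notin> - {p}" by auto
  have "\<exists>H. (\<forall>c x. (H c has_vector_derivative \<tau> * (c * H c x - P x * ((\<Prod>m\<in>UNIV. c - \<alpha> m) * F x))) (at x))
      \<and> (\<forall>c x. H c x = (\<Sum>m\<in>UNIV. H (\<alpha> m) x * l m c))"
    using weighted_char_minor_primitive[OF \<tau> l compl(2), of \<beta> A] unfolding compl(1) char_avg P_def .
  then obtain H where H: "\<And>c x. (H c has_vector_derivative \<tau> * (c * H c x - P x * ((\<Prod>m\<in>UNIV. c - \<alpha> m) * F x))) (at x)"
    and H_l: "\<And>c x. H c x = (\<Sum>m\<in>UNIV. H (\<alpha> m) x * l m c)"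
    by blast
  define d where "d = b p - b j"
  have shift_root: "H (\<alpha> m) (x + d) = \<rho> * H (\<alpha> m) x" for m x
  proof -
    \<comment> \<open>Integrating factor: at a root \<open>c = \<alpha> m\<close> the inhomogeneous
      term vanishes, and \<open>H (\<alpha> m)\<close> solves a homogeneous linear equation with
      rate \<open>\<tau> * \<alpha> m\<close>.\<close>
    have "((\<lambda>x. exp (- (\<tau> * \<alpha> m) * complex_of_real x) * H (\<alpha> m) x) has_vector_derivative 0) (at x)" for x
    proof -
      have "((exp \<circ> (\<lambda>x. - (\<tau> * \<alpha> m) * complex_of_real x)) has_vector_derivative
          - (\<tau> * \<alpha> m) * exp (- (\<tau> * \<alpha> m) * complex_of_real x)) (at x)"
        by (rule field_vector_diff_chain_at) (auto intro!: derivative_eq_intros)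
      moreover have "(H (\<alpha> m) has_vector_derivative \<tau> * (\<alpha> m * H (\<alpha> m) x)) (at x)"
      proof -
        have zero: "(\<Prod>k\<in>UNIV. \<alpha> m - \<alpha> k) = 0" by (rule prod_zero) auto
        show ?thesis using H[of "\<alpha> m" x] unfolding zero by simp
      qed
      ultimately have "((\<lambda>x. (exp \<circ> (\<lambda>x. - (\<tau> * \<alpha> m) * complex_of_real x)) x * H (\<alpha> m) x) has_vector_derivative
          (exp \<circ> (\<lambda>x. - (\<tau> * \<alpha> m) * complex_of_real x)) x * (\<tau> * (\<alpha> m * H (\<alpha> m) x))
          + - (\<tau> * \<alpha> m) * exp (- (\<tau> * \<alpha> m) * complex_of_real x) * H (\<alpha> m) x) (at x)"
        by (rule has_vector_derivative_mult)
      also have "(exp \<circ> (\<lambda>x. - (\<tau> * \<alpha> m) * complex_of_real x)) x * (\<tau> * (\<alpha> m * H (\<alpha> m) x))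
          + - (\<tau> * \<alpha> m) * exp (- (\<tau> * \<alpha> m) * complex_of_real x) * H (\<alpha> m) x = 0"
        by simp
      finally show ?thesis by (simp only: o_def)
    qed
    then obtain k where k: "\<And>x. exp (- (\<tau> * \<alpha> m) * complex_of_real x) * H (\<alpha> m) x = k"
      using has_vector_derivative_zero_constant[of UNIV] by auto
    have sol: "H (\<alpha> m) x = exp (\<tau> * \<alpha> m * complex_of_real x) * k" for x
    proof -
      have "H (\<alpha> m) x = exp (\<tau> * \<alpha> m * complex_of_real x) * (exp (- (\<tau> * \<alpha> m) * complex_of_real x) * H (\<alpha> m) x)"
        by (simp add: mult.assoc[symmetric] exp_add[symmetric])
      then show ?thesis by (simp only: k)
    qed
    show ?thesis
      unfolding sol by (simp add: period[of m, folded d_def, symmetric] distrib_left exp_add)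
  qed
  have shift: "H c (x + d) = \<rho> * H c x" for c x
    unfolding H_l[of c] by (simp add: shift_root sum_distrib_left mult.assoc)
  \<comment> \<open>Off the spectrum the characteristic polynomial is nonzero and can be cancelled
    at the end.\<close>
  obtain c where c: "c \<notin> range \<alpha>"
    using ex_new_if_finite[OF infinite_UNIV_char_0, of "range \<alpha>"] by auto
  \<comment> \<open>The shifted function \<open>H c (x + d)\<close> is differentiated at
    \<open>b j\<close> in two ways, and \<open>shift\<close> cancels the terms with
    \<open>c * H c\<close>. Here \<open>b j + d\<close> is \<open>b p\<close>, and the right-hand
    side vanishes with \<open>P (b j)\<close>.\<close>
  have "P (b j + d) * ((\<Prod>m\<in>UNIV. c - \<alpha> m) * F (b j + d)) = \<rho> * (P (b j) * ((\<Prod>m\<in>UNIV. c - \<alpha> m) * F (b j)))"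
  proof -
    have "((\<lambda>x. x + d) has_vector_derivative 1) (at (b j))"
      by (auto intro!: derivative_eq_intros)
    from vector_diff_chain_at[OF this H]
    have "((\<lambda>x. H c (x + d)) has_vector_derivative
        \<tau> * (c * H c (b j + d) - P (b j + d) * ((\<Prod>m\<in>UNIV. c - \<alpha> m) * F (b j + d)))) (at (b j))"
      by (simp add: o_def)
    moreover have "((\<lambda>x. H c (x + d)) has_vector_derivative
        \<rho> * (\<tau> * (c * H c (b j) - P (b j) * ((\<Prod>m\<in>UNIV. c - \<alpha> m) * F (b j))))) (at (b j))"
      unfolding shift by (intro has_vector_derivative_mult_right H)
    ultimately have "\<tau> * (c * H c (b j + d) - P (b j + d) * ((\<Prod>m\<in>UNIV. c - \<alpha> m) * F (b j + d)))
       = \<rho> * (\<tau> * (c * H c (b j) - P (b j) * ((\<Prod>m\<in>UNIV. c - \<alpha> m) * F (b j))))"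
      by (rule vector_derivative_unique_at)
    then have "\<tau> * (P (b j + d) * ((\<Prod>m\<in>UNIV. c - \<alpha> m) * F (b j + d)))
       = \<tau> * (\<rho> * (P (b j) * ((\<Prod>m\<in>UNIV. c - \<alpha> m) * F (b j))))"
      unfolding shift by algebra
    then show ?thesis by (rule mult_left_cancel[OF \<tau>, THEN iffD1])
  qed
  moreover have "P (b j) = 0"
    using pj by (auto simp: P_def \<beta>_def)
  moreover have "P (b p) \<noteq> 0"
    using b by (auto simp: P_def \<beta>_def dest: injD)
  moreover have "(\<Prod>m\<in>UNIV. c - \<alpha> m) \<noteq> 0"
    using c by auto
  ultimately have "F (b p) = 0" by (simp add: d_def)
  moreover have "\<beta>(p := complex_of_real (b p)) = (\<lambda>m. complex_of_real (b m))"
    by (auto simp: \<beta>_def)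
  ultimately show ?thesis by (simp add: F_def)
qed

end

subsection \<open>Diagonalization\<close>

definition diag :: "('n \<Rightarrow> complex) \<Rightarrow> complex ^ 'n ^ 'n" where
  "diag d = (\<chi> i j. if i = j then d i else 0)"

lemma diag_mult_nth: "(diag d ** M) $ i $ j = d i * M $ i $ j"
proof -
  have "(diag d ** M) $ i $ j = (\<Sum>k\<in>{i}. diag d $ i $ k * M $ k $ j)"
    unfolding matrix_mult_nth by (rule sum.mono_neutral_right) (auto simp: diag_def)
  then show ?thesis by (simp add: diag_def)
qed

lemma mult_diag_nth: "(M ** diag d) $ i $ j = M $ i $ j * d j"
proof -
  have "(M ** diag d) $ i $ j = (\<Sum>k\<in>{j}. M $ i $ k * diag d $ k $ j)"
    unfolding matrix_mult_nth by (rule sum.mono_neutral_right) (auto simp: diag_def)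
  then show ?thesis by (simp add: diag_def)
qed

text \<open>Scalar matrices commute with \<open>U\<close>, so the characteristic matrix is itself
  the conjugate of \<open>diag (\<lambda>m. c - \<alpha> m)\<close>, and the determinants of the
  unitary factors cancel.\<close>

lemma det_char_minor_unitary_conjugate:
  assumes "U \<in> unitary_group"
  shows "det (char_minor UNIV (U ** diag \<alpha> ** conj_transpose U) c) = (\<Prod>m\<in>UNIV. c - \<alpha> m)"
proof -
  have U: "U ** conj_transpose U = mat 1"
    using assms by (simp add: unitary_group_def)
  have "(U ** diag (\<lambda>m. c - \<alpha> m) ** conj_transpose U) $ i $ j =
      c * (U ** conj_transpose U) $ i $ j - (U ** diag \<alpha> ** conj_transpose U) $ i $ j" for i j
    unfolding matrix_mult_nth[of _ "conj_transpose U"] mult_diag_nth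
    by (simp add: sum_distrib_left sum_subtractf algebra_simps)
  then have "char_minor UNIV (U ** diag \<alpha> ** conj_transpose U) c = U ** diag (\<lambda>m. c - \<alpha> m) ** conj_transpose U"
    by (simp add: vec_eq_iff char_minor_nth U mat_def axis_def)
  then have "det (char_minor UNIV (U ** diag \<alpha> ** conj_transpose U) c) =
      det (U ** conj_transpose U) * det (diag (\<lambda>m. c - \<alpha> m))"
    by (simp add: det_mul mult_ac)
  also have "\<dots> = (\<Prod>m\<in>UNIV. c - \<alpha> m)"
    unfolding U by (simp add: det_diagonal diag_def)
  finally show ?thesis .
qed

text \<open>Eigenvectors of a Hermitian matrix for distinct real eigenvalues are orthogonal.
  Injectivity of \<open>\<alpha>\<close> gives one for each index, enough to fill the columns of a
  unitary matrix after normalization.\<close>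

lemma hermitian_diagonalization:
  fixes A :: "complex ^ 'n ^ 'n" and \<alpha> :: "'n \<Rightarrow> real"
  assumes A: "hermitian A" and "inj \<alpha>" and eig: "\<And>m. eigenvalue A (complex_of_real (\<alpha> m))"
  obtains V where "V \<in> unitary_group" "A = V ** diag (\<lambda>m. complex_of_real (\<alpha> m)) ** conj_transpose V"
proof -
  define ip where "ip x y = (\<Sum>k\<in>UNIV. cnj (x $ k) * y $ k)" for x y :: "complex ^ 'n"
  have A_cnj: "cnj (A $ i $ j) = A $ j $ i" for i j
    using arg_cong[OF A[unfolded hermitian_def], of "\<lambda>M. M $ j $ i"] by simp
  have "\<exists>v. v \<noteq> 0 \<and> A *v v = complex_of_real (\<alpha> m) *s v" for m
    using eig[of m] by (simp add: eigenvalue_def)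
  then obtain w where w: "\<And>m. w m \<noteq> 0" "\<And>m. A *v w m = complex_of_real (\<alpha> m) *s w m"
    by metis
  have ip_self: "ip x x = complex_of_real (\<Sum>k\<in>UNIV. (norm (x $ k))\<^sup>2)" for x
    by (simp add: ip_def complex_norm_square mult.commute del: of_real_power)
  have pos: "0 < (\<Sum>k\<in>UNIV. (norm (w m $ k))\<^sup>2)" for m
  proof -
    obtain k where "w m $ k \<noteq> 0" using w(1)[of m] by (auto simp: vec_eq_iff)
    then show ?thesis by (intro sum_pos2[of UNIV k]) auto
  qed
  define V :: "complex ^ 'n ^ 'n" where
    "V = (\<chi> i m. w m $ i / complex_of_real (sqrt (\<Sum>k\<in>UNIV. (norm (w m $ k))\<^sup>2)))"
  have ip_mult: "ip x (A *v y) = ip (A *v x) y" for x y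
  proof -
    have "ip x (A *v y) = (\<Sum>i\<in>UNIV. \<Sum>j\<in>UNIV. cnj (x $ i) * A $ i $ j * y $ j)"
      by (simp add: ip_def matrix_vector_mult_def sum_distrib_left mult.assoc)
    also have "\<dots> = (\<Sum>j\<in>UNIV. \<Sum>i\<in>UNIV. cnj (x $ i) * A $ i $ j * y $ j)"
      by (rule sum.swap)
    also have "\<dots> = ip (A *v x) y"
      by (simp add: ip_def matrix_vector_mult_def sum_distrib_left sum_distrib_right A_cnj mult_ac)
    finally show ?thesis .
  qed
  have orth: "ip (w m) (w k) = 0" if "m \<noteq> k" for m k
  proof -
    have "complex_of_real (\<alpha> k) * ip (w m) (w k) = complex_of_real (\<alpha> m) * ip (w m) (w k)"
      using ip_mult[of "w m" "w k"] unfolding w(2)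
      by (simp add: ip_def sum_distrib_left mult_ac)
    moreover have "\<alpha> k \<noteq> \<alpha> m" using \<open>inj \<alpha>\<close> that by (auto dest: injD)
    ultimately show ?thesis by simp
  qed
  have left: "conj_transpose V ** V = mat 1"
  proof -
    have "(conj_transpose V ** V) $ m $ k = (if m = k then 1 else 0)" for m k
    proof -
      have "(conj_transpose V ** V) $ m $ k = ip (w m) (w k) /
          complex_of_real (sqrt (\<Sum>i\<in>UNIV. (norm (w m $ i))\<^sup>2) * sqrt (\<Sum>i\<in>UNIV. (norm (w k $ i))\<^sup>2))"
        by (simp add: matrix_mult_nth V_def ip_def sum_divide_distrib)
      then show ?thesis
        using pos[of k] by (cases "m = k") (simp_all add: orth ip_self del: of_real_mult of_real_sum)
    qed
    then show ?thesis by (simp add: vec_eq_iff mat_def)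
  qed
  then have right: "V ** conj_transpose V = mat 1"
    by (simp add: matrix_left_right_inverse)
  have "A ** V = V ** diag (\<lambda>m. complex_of_real (\<alpha> m))"
  proof -
    have "(A ** V) $ i $ m = (A *v w m) $ i / complex_of_real (sqrt (\<Sum>k\<in>UNIV. (norm (w m $ k))\<^sup>2))" for i m
      by (simp add: matrix_mult_nth V_def matrix_vector_mult_def sum_divide_distrib)
    then show ?thesis
      by (simp add: vec_eq_iff mult_diag_nth w(2) V_def)
  qed
  then have "A ** (V ** conj_transpose V) = V ** diag (\<lambda>m. complex_of_real (\<alpha> m)) ** conj_transpose V"
    by (simp add: matrix_mul_assoc)
  with left right show ?thesis
    by (intro that[of V]) (simp_all add: unitary_group_def)
qed

text \<open>The spectrum is given as a set, without multiplicities. Strict monotonicity yields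
  \<open>CARD('n)\<close> distinct elements, so every eigenvalue is simple; \<open>\<iota>\<close>
  carries the numbering over to the matrix indices.\<close>

lemma hermitian_diagonalization_simple_spectrum:
  fixes A :: "complex ^ 'n ^ 'n" and a :: "nat \<Rightarrow> real" and \<iota> :: "'n \<Rightarrow> nat"
  assumes "hermitian A" and spec: "{c. eigenvalue A c} = (\<lambda>m. complex_of_real (a m)) ` {1..CARD('n)}"
    and "strict_mono_on {1..CARD('n)} a" and \<iota>: "bij_betw \<iota> UNIV {1..CARD('n)}"
  obtains V where "V \<in> unitary_group" "A = V ** diag (\<lambda>m. complex_of_real (a (\<iota> m))) ** conj_transpose V" "inj (\<lambda>m. a (\<iota> m))"
proof -
  have "inj (a \<circ> \<iota>)"
    using comp_inj_on[of \<iota> UNIV a] \<iota> strict_mono_on_imp_inj_on[OF assms(3)] by (auto simp: bij_betw_def)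
  then have inj: "inj (\<lambda>m. a (\<iota> m))" by (simp add: o_def)
  have "eigenvalue A (complex_of_real (a (\<iota> m)))" for m
    using spec bij_betwE[OF \<iota>] by blast
  then show ?thesis
    using hermitian_diagonalization[OF assms(1) inj] that inj by blast
qed

lemma trace_diag_mult: "trace (diag d ** M) = (\<Sum>l\<in>UNIV. d l * M $ l $ l)"
  by (simp add: trace_def diag_mult_nth)

text \<open>Inversion invariance and cyclicity of the trace move the conjugation from
  \<open>B\<close> to \<open>A\<close>; left translation by \<open>V\<close> absorbs the
  diagonalizing unitary.\<close>

lemma (in haar_unitary) hciz_eq_weighted_avg:
  assumes V: "V \<in> unitary_group" and B: "B = V ** diag d ** conj_transpose V"
  shows "hciz \<kappa> z A B = weighted_avg A (- z * of_nat CARD('n)) d (\<lambda>_. 1)"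
proof -
  define f where "f = (\<lambda>U. exp (- z * of_nat CARD('n) * trace (A ** conj_transpose U ** B ** U)))"
  have cont: "continuous_on S f" for S
    unfolding f_def trace_def by (intro continuous_intros)
  have "hciz \<kappa> z A B = (\<integral>U. f (conj_transpose U) \<partial>\<kappa>)"
    unfolding hciz_def
    by (rule Bochner_Integration.integral_cong) (simp_all add: f_def space_haar matrix_inv_unitary)
  also have "\<dots> = (\<integral>U. f U \<partial>\<kappa>)"
    by (rule integral_inverse[OF cont])
  also have "\<dots> = (\<integral>U. f (V ** U) \<partial>\<kappa>)"
    by (rule integral_mult_left[OF V cont, symmetric])
  also have "\<dots> = weighted_avg A (- z * of_nat CARD('n)) d (\<lambda>_. 1)"
  proof -
    have "trace (A ** conj_transpose (V ** U) ** B ** (V ** U))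
        = (\<Sum>l\<in>UNIV. d l * (U ** A ** conj_transpose U) $ l $ l)" for U
    proof -
      have VV: "conj_transpose V ** V = mat 1" using V by (simp add: unitary_group_def)
      have "A ** conj_transpose (V ** U) ** B ** (V ** U)
          = A ** conj_transpose U ** (conj_transpose V ** V) ** diag d ** (conj_transpose V ** V) ** U"
        by (simp only: B conj_transpose_mult matrix_mul_assoc)
      also have "\<dots> = (A ** conj_transpose U) ** (diag d ** U)"
        by (simp only: VV matrix_mul_rid matrix_mul_assoc)
      finally have "trace (A ** conj_transpose (V ** U) ** B ** (V ** U)) = trace ((A ** conj_transpose U) ** (diag d ** U))"
        by (rule arg_cong)
      also have "\<dots> = trace ((diag d ** U) ** (A ** conj_transpose U))"
        by (rule trace_mul_sym)
      also have "\<dots> = trace (diag d ** (U ** A ** conj_transpose U))"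
        by (simp only: matrix_mul_assoc)
      finally show ?thesis by (simp only: trace_diag_mult)
    qed
    then show ?thesis by (simp add: f_def weighted_avg_def)
  qed
  finally show ?thesis .
qed

theorem theorem0p6:
  fixes A B :: "complex ^ 'n ^ 'n"
    and \<kappa> :: "(complex ^ 'n ^ 'n) measure"
    and a b :: "nat \<Rightarrow> real" and h :: real
    and i j :: nat and k :: int
  assumes "normalized_haar_unitary \<kappa>"
    and "hermitian A"
    and "{c. eigenvalue A c} = (\<lambda>m. complex_of_real (a m)) ` {1..CARD('n)}"
    and "h > 0"
    and "\<forall>m \<in> {1..CARD('n)}. a m = a 1 + (real m - 1) * h"
    and "hermitian B"
    and "{c. eigenvalue B c} = (\<lambda>m. complex_of_real (b m)) ` {1..CARD('n)}"
    and "strict_mono_on {1..CARD('n)} b"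
    and "1 \<le> i" and "i < j" and "j \<le> CARD('n)"
    and "k \<noteq> 0"
  shows "hciz \<kappa> (complex_of_real (2 * of_int k * pi / (real CARD('n) * h * (b j - b i))) * \<i>) A B = 0"
proof -
  interpret haar_unitary \<kappa> by unfold_locales fact
  \<comment> \<open>With \<open>h > 0\<close> the progression is strictly increasing, so
    \<open>A\<close> has simple spectrum.\<close>
  have mono_a: "strict_mono_on {1..CARD('n)} a"
  proof (rule strict_mono_onI)
    fix r s assume "r \<in> {1..CARD('n)}" "s \<in> {1..CARD('n)}" "r < s"
    then show "a r < a s"
      using assms(5)[rule_format, of r] assms(5)[rule_format, of s] \<open>h > 0\<close> by simp
  qed
  obtain \<iota> :: "'n \<Rightarrow> nat" where \<iota>: "bij_betw \<iota> UNIV {1..CARD('n)}"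
    using finite_same_card_bij[of "UNIV :: 'n set" "{1..CARD('n)}"] by auto
  obtain V where V: "V \<in> unitary_group" "A = V ** diag (\<lambda>m. complex_of_real (a (\<iota> m))) ** conj_transpose V"
    and inj_a: "inj (\<lambda>m. a (\<iota> m))"
    using hermitian_diagonalization_simple_spectrum[OF assms(2,3) mono_a \<iota>] by blast
  obtain W where W: "W \<in> unitary_group" "B = W ** diag (\<lambda>m. complex_of_real (b (\<iota> m))) ** conj_transpose W"
    and inj_b: "inj (\<lambda>m. b (\<iota> m))"
    using hermitian_diagonalization_simple_spectrum[OF assms(6,7,8) \<iota>] by blast
  obtain p q where p: "\<iota> p = i" and q: "\<iota> q = j"
    using bij_betw_imp_surj_on[OF \<iota>] assms(9-11)
    by (metis atLeastAtMost_iff imageE less_imp_le_nat order_trans)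
  define z where "z = complex_of_real (2 * of_int k * pi / (real CARD('n) * h * (b j - b i))) * \<i>"
  define \<tau> where "\<tau> = - z * of_nat CARD('n)"
  have bij: "b i < b j"
    using strict_mono_onD[OF assms(8)] assms(9-11) by simp
  \<comment> \<open>The minus sign in \<open>\<tau>\<close> and the reversed difference
    \<open>b i - b j\<close> cancel, as do the dimension and the gap.\<close>
  have \<tau>: "\<tau> * complex_of_real (b i - b j) = complex_of_real (2 * of_int k * pi / h) * \<i>"
    using bij \<open>h > 0\<close> by (simp add: \<tau>_def z_def field_simps)
  \<comment> \<open>Here \<open>k \<noteq> 0\<close> enters: \<open>k = 0\<close> would give
    \<open>z = 0\<close>, where the integral equals 1.\<close>
  have "\<tau> \<noteq> 0"
    using bij \<open>h > 0\<close> \<open>k \<noteq> 0\<close> by (simp add: \<tau>_def z_def)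
  have "weighted_avg A \<tau> (\<lambda>m. complex_of_real (b (\<iota> m))) (\<lambda>_. 1) = 0"
  proof (rule weighted_avg_eq_0[where \<alpha> = "\<lambda>m. complex_of_real (a (\<iota> m))" and p = p and j = q])
    show "inj (\<lambda>m. complex_of_real (a (\<iota> m)))"
      using inj_a by (simp add: inj_def)
    show "p \<noteq> q" using p q \<open>i < j\<close> by auto
    show "det (char_minor UNIV (U ** A ** conj_transpose U) c) = (\<Prod>m\<in>UNIV. c - complex_of_real (a (\<iota> m)))"
      if "U \<in> unitary_group" for U c
    proof -
      have "U ** A ** conj_transpose U =
          (U ** V) ** diag (\<lambda>m. complex_of_real (a (\<iota> m))) ** conj_transpose (U ** V)"
        by (simp only: V(2) conj_transpose_mult matrix_mul_assoc)
      then show ?thesis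
        by (simp only: det_char_minor_unitary_conjugate[OF unitary_mult[OF that V(1)]])
    qed
    \<comment> \<open>Each step \<open>h\<close> of the progression contributes the exponential of
      \<open>2 * k * pi * \<i>\<close>, which is 1, so all eigenvalues share the multiplier of
      \<open>a 1\<close>.\<close>
    show "exp (\<tau> * complex_of_real (a (\<iota> m)) * complex_of_real (b (\<iota> p) - b (\<iota> q)))
        = exp (\<tau> * complex_of_real (a 1) * complex_of_real (b i - b j))" for m
    proof -
      have "\<iota> m \<in> {1..CARD('n)}" using bij_betwE[OF \<iota>] by blast
      then have "a (\<iota> m) = a 1 + (real (\<iota> m) - 1) * h" using assms(5) by blast
      then have "\<tau> * complex_of_real (a (\<iota> m)) * complex_of_real (b i - b j)
          = \<tau> * complex_of_real (a 1) * complex_of_real (b i - b j)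
            + complex_of_real ((real (\<iota> m) - 1) * h) * (\<tau> * complex_of_real (b i - b j))"
        by (simp only: of_real_add) (simp only: distrib_left distrib_right mult_ac)
      also have "complex_of_real ((real (\<iota> m) - 1) * h) * (\<tau> * complex_of_real (b i - b j))
          = complex_of_real (((real (\<iota> m) - 1) * h) * (2 * of_int k * pi / h)) * \<i>"
        by (simp only: \<tau> of_real_mult mult.assoc)
      also have "((real (\<iota> m) - 1) * h) * (2 * of_int k * pi / h) = 2 * of_int ((int (\<iota> m) - 1) * k) * pi"
        using \<open>h > 0\<close> by simp
      also have "exp (\<tau> * complex_of_real (a 1) * complex_of_real (b i - b j)
            + complex_of_real (2 * of_int ((int (\<iota> m) - 1) * k) * pi) * \<i>)
          = exp (\<tau> * complex_of_real (a 1) * complex_of_real (b i - b j))"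
        using exp_integer_2pi[of "of_int ((int (\<iota> m) - 1) * k)"] by (simp only: exp_add) simp
      finally show ?thesis by (simp only: p q)
    qed
  qed (rule \<open>\<tau> \<noteq> 0\<close> inj_b)+
  then show ?thesis
    using hciz_eq_weighted_avg[OF W, of z A] by (simp only: \<tau>_def z_def)
qed

end
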